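(* Let $\mathcal{K}$ and $\mathcal{K}'$ be admissible $d$-complexes, and let $\mathcal{K}\sqcup\mathcal{K}'$ be their disjoint union. Then $$V_{\mathbb{Q}}(\mathcal{K}\sqcup\mathcal{K}') = V_{\mathbb{Q}}(\mathcal{K})+V_{\mathbb{Q}}(\mathcal{K}').$$
   Context: An admissible $d$-complex is a finite pure simplicial $d$-complex $\mathcal{K}$ (every simplex is a face of a $d$-simplex of $\mathcal{K}$) in which each facet ($d$-simplex) is equipped with an orientation, giving oriented facets $F_1,\dots,F_n$, such that $\sum_i\partial F_i=0$. We also write $\mathcal{K}$ for the $d$-chain $\sum_i F_i$. $C_n(\mathcal{K};\mathbb{Q})$ denotes the chains, with coefficients in $\mathbb{Q}$, of oriented $n$-simplices on the vertices of $\mathcal{K}$: any $n+1$ distinct vertices of $\mathcal{K}$ span an allowed $n$-simplex, whether or not it is a simplex of $\mathcal{K}$, and an oriented simplex with reversed orientation equals minus the original. The boundary is $\partial[v_0,\dots,v_n]=\sum_i(-1)^i[v_0,\dots,\widehat{v_i},\dots,v_n]$. For a chain $\alpha$, $|\alpha|_1$ is the sum of the absolute values of its coefficients (with one chosen orientation per simplex). $V_{\mathbb{Q}}(\mathcal{K})$ is the smallest value of $|\alpha|_1$ over all $\alpha\in C_{d+1}(\mathcal{K};\mathbb{Q})$ with $\partial\alpha=\mathcal{K}$. The disjoint union $\mathcal{K}\sqcup\mathcal{K}'$ is the admissible $d$-complex whose vertex set is the disjoint union of the two vertex sets and whose oriented facets are those of $\mathcal{K}$ together with those of $\mathcal{K}'$.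 *)

theory Defs
  imports Complex_Main "HOL-Combinatorics.Permutations"
begin

text \<open>
  A rational chain is represented by its coefficient function on ordered simplices: the value at
  \<open>[v\<^sub>0, \<dots>, v\<^sub>n]\<close> is the coefficient of that oriented simplex. Reversing an
  orientation changes the sign, so such a function is alternating under reordering.
\<close>

type_synonym 'a chain = "'a list \<Rightarrow> rat"

text \<open>
  The generator \<open>[v\<^sub>0, \<dots>, v\<^sub>n]\<close>. For distinct vertices the sum below has at most
  one term, so the value at a reordering of the vertices is its sign, and it is zero elsewhere.
\<close>

definition simplex_chain :: "'a list \<Rightarrow> 'a chain" where
  "simplex_chain vs ws =
     (\<Sum>\<pi> | \<pi> permutes {..<length vs} \<and> permute_list \<pi> vs = ws. of_int (sign \<pi>))"

definition chains :: "nat \<Rightarrow> 'a set \<Rightarrow> 'a chain set" where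
  "chains n V =
     {c. (\<forall>vs. c vs \<noteq> 0 \<longrightarrow> distinct vs \<and> length vs = n + 1 \<and> set vs \<subseteq> V) \<and>
         (\<forall>vs \<pi>. \<pi> permutes {..<length vs} \<longrightarrow>
            c (permute_list \<pi> vs) = of_int (sign \<pi>) * c vs)}"

definition chain_simplices :: "'a chain \<Rightarrow> 'a set set" where
  "chain_simplices c = set ` {vs. c vs \<noteq> 0}"

text \<open>One chosen orientation for each finite set of vertices.\<close>

definition chosen_ordering :: "'a set \<Rightarrow> 'a list" where
  "chosen_ordering S = (SOME vs. distinct vs \<and> set vs = S)"

definition chain_norm :: "'a chain \<Rightarrow> rat" where
  "chain_norm c = (\<Sum>S\<in>chain_simplices c. \<bar>c (chosen_ordering S)\<bar>)"

definition delete_nth :: "nat \<Rightarrow> 'a list \<Rightarrow> 'a list" where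
  "delete_nth i vs = take i vs @ drop (Suc i) vs"

text \<open>
  The boundary formula is taken literally also for a single vertex: the boundary of \<open>[v]\<close> is
  the empty simplex \<open>[]\<close>, as in the augmented chain complex.
\<close>

definition simplex_boundary :: "'a list \<Rightarrow> 'a chain" where
  "simplex_boundary vs ws =
     (\<Sum>i<length vs. (-1) ^ i * simplex_chain (delete_nth i vs) ws)"

text \<open>
  Linear extension. The result does not depend on the chosen orderings; see
  \<open>boundary_simplex_chain\<close> below.
\<close>

definition boundary :: "'a chain \<Rightarrow> 'a chain" where
  "boundary c ws =
     (\<Sum>S\<in>chain_simplices c. c (chosen_ordering S) * simplex_boundary (chosen_ordering S) ws)"

text \<open>
  An oriented facet \<open>(s, vs)\<close> stands for \<open>s\<close> times \<open>vs\<close>, where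
  \<open>s\<close> is 1 or -1. The sign is redundant for simplices of positive dimension, but a single
  vertex has only one ordering and two orientations.
\<close>

record 'a oriented_complex =
  simplices :: "'a set set"
  oriented_facets :: "(int \<times> 'a list) set"

definition vertices :: "'a oriented_complex \<Rightarrow> 'a set" where
  "vertices K = \<Union> (simplices K)"

definition facets :: "nat \<Rightarrow> 'a oriented_complex \<Rightarrow> 'a set set" where
  "facets d K = {S \<in> simplices K. card S = d + 1}"

definition facet_chain :: "int \<times> 'a list \<Rightarrow> 'a chain" where
  "facet_chain F ws = of_int (fst F) * simplex_chain (snd F) ws"

definition complex_chain :: "'a oriented_complex \<Rightarrow> 'a chain" where
  "complex_chain K ws = (\<Sum>F\<in>oriented_facets K. facet_chain F ws)"

definition simplicial_complex :: "'a set set \<Rightarrow> bool" where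
  "simplicial_complex X \<longleftrightarrow>
     (\<forall>S\<in>X. finite S \<and> S \<noteq> {}) \<and> (\<forall>S\<in>X. \<forall>T. T \<subseteq> S \<and> T \<noteq> {} \<longrightarrow> T \<in> X)"

definition admissible_complex :: "nat \<Rightarrow> 'a oriented_complex \<Rightarrow> bool" where
  "admissible_complex d K \<longleftrightarrow>
     simplicial_complex (simplices K) \<and> finite (simplices K) \<and>
     (\<forall>S\<in>simplices K. \<exists>T\<in>facets d K. S \<subseteq> T) \<and>
     (\<forall>(s, vs)\<in>oriented_facets K. (s = 1 \<or> s = -1) \<and> distinct vs) \<and>
     bij_betw (\<lambda>(s, vs). set vs) (oriented_facets K) (facets d K) \<and>
     (\<forall>ws. (\<Sum>F\<in>oriented_facets K. boundary (facet_chain F) ws) = 0)"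

text \<open>The least norm of a filling, as a minimum over rational chains.\<close>

definition VQ :: "nat \<Rightarrow> 'a oriented_complex \<Rightarrow> rat" where
  "VQ d K = (LEAST r. \<exists>\<alpha>\<in>chains (d + 1) (vertices K).
                        boundary \<alpha> = complex_chain K \<and> r = chain_norm \<alpha>)"

definition disjoint_union ::
    "'a oriented_complex \<Rightarrow> 'b oriented_complex \<Rightarrow> ('a + 'b) oriented_complex"
    (infixl "\<squnion>\<^sub>c" 65) where
  "K \<squnion>\<^sub>c K' =
     \<lparr>simplices = (`) Inl ` simplices K \<union> (`) Inr ` simplices K',
      oriented_facets = map_prod id (map Inl) ` oriented_facets K \<union>
                        map_prod id (map Inr) ` oriented_facets K'\<rparr>"

lemma vertices_disjoint_union:
  "vertices (K \<squnion>\<^sub>c K') = Inl ` vertices K \<union> Inr ` vertices K'"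
  by (auto simp: vertices_def disjoint_union_def)

lemma simplex_chain_permute_list:
  assumes p: "\<pi> permutes {..<length vs}"
  shows "simplex_chain (permute_list \<pi> vs) ws = of_int (sign \<pi>) * simplex_chain vs ws"
proof -
  let ?A = "{\<sigma>. \<sigma> permutes {..<length vs} \<and> permute_list \<sigma> (permute_list \<pi> vs) = ws}"
  let ?B = "{\<sigma>. \<sigma> permutes {..<length vs} \<and> permute_list \<sigma> vs = ws}"
  have inv: "inv \<pi> permutes {..<length vs}" using p by (rule permutes_inv)
  have "(\<Sum>\<sigma>\<in>?B. of_int (sign \<pi>) * of_int (sign \<sigma>)) = (\<Sum>\<sigma>\<in>?A. (of_int (sign \<sigma>) :: rat))"
  proof (rule sum.reindex_bij_witness[of _ "\<lambda>\<sigma>. \<pi> \<circ> \<sigma>" "\<lambda>\<sigma>. inv \<pi> \<circ> \<sigma>"])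
    fix \<sigma> assume s: "\<sigma> \<in> ?B"
    show "\<pi> \<circ> (inv \<pi> \<circ> \<sigma>) = \<sigma>"
      using permutes_inv_o(1)[OF p] by (simp add: o_assoc)
    have q: "inv \<pi> \<circ> \<sigma> permutes {..<length vs}"
      using s inv by (auto intro: permutes_compose)
    have "permute_list (inv \<pi> \<circ> \<sigma>) (permute_list \<pi> vs) = permute_list (\<pi> \<circ> (inv \<pi> \<circ> \<sigma>)) vs"
      by (rule permute_list_compose[symmetric]) (use q in auto)
    then show "inv \<pi> \<circ> \<sigma> \<in> ?A"
      using q s permutes_inv_o(1)[OF p] by (auto simp: o_assoc)
    have "sign (inv \<pi> \<circ> \<sigma>) = sign \<pi> * sign \<sigma>"
      using p s inv by (subst sign_compose)
        (auto simp: sign_inverse permutes_imp_permutation[OF finite_lessThan])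
    then show "of_int (sign (inv \<pi> \<circ> \<sigma>)) = of_int (sign \<pi>) * (of_int (sign \<sigma>) :: rat)"
      by simp
  next
    fix \<sigma> assume s: "\<sigma> \<in> ?A"
    show "inv \<pi> \<circ> (\<pi> \<circ> \<sigma>) = \<sigma>"
      using permutes_inv_o(2)[OF p] by (simp add: o_assoc)
    have "permute_list (\<pi> \<circ> \<sigma>) vs = permute_list \<sigma> (permute_list \<pi> vs)"
      by (rule permute_list_compose) (use s in auto)
    then show "\<pi> \<circ> \<sigma> \<in> ?B" using s p by (auto intro: permutes_compose)
  qed
  then show ?thesis by (simp add: simplex_chain_def sum_distrib_left)
qed

lemma simplex_chain_swap:
  "simplex_chain (a @ y # x # b) ws = - simplex_chain (a @ x # y # b) ws"
proof -
  let ?t = "Transposition.transpose (length a) (Suc (length a))"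
  have p: "?t permutes {..<length (a @ x # y # b)}"
    by (rule permutes_swap_id) auto
  have "permute_list ?t (a @ x # y # b) = a @ y # x # b"
  proof (rule nth_equalityI)
    fix i assume "i < length (permute_list ?t (a @ x # y # b))"
    then show "permute_list ?t (a @ x # y # b) ! i = (a @ y # x # b) ! i"
      by (subst permute_list_nth[OF p])
        (auto simp: Transposition.transpose_def nth_append nth_Cons split: nat.splits)
  qed simp
  with simplex_chain_permute_list[OF p, of ws] show ?thesis
    by (simp add: sign_swap_id)
qed

lemma simplex_boundary_swap:
  "simplex_boundary (a @ y # x # b) ws = - simplex_boundary (a @ x # y # b) ws"
proof -
  let ?n = "length a"
  let ?t = "Transposition.transpose ?n (Suc ?n)"
  let ?us = "a @ y # x # b" and ?vs = "a @ x # y # b"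
  have main: "(-1) ^ ?t i * simplex_chain (delete_nth (?t i) ?us) ws =
        - ((-1) ^ i * simplex_chain (delete_nth i ?vs) ws)" for i
  proof -
    consider "i < ?n" | "i = ?n" | "i = Suc ?n" | "i > Suc ?n" by linarith
    then show ?thesis
    proof cases
      case 1
      then have "delete_nth i ?us = delete_nth i a @ y # x # b"
        "delete_nth i ?vs = delete_nth i a @ x # y # b"
        by (auto simp: delete_nth_def)
      then show ?thesis using 1 simplex_chain_swap[of "delete_nth i a" y x b ws]
        by simp
    next
      case 4
      then obtain k where k: "i = ?n + 2 + k"
        by (metis Suc_leI add_2_eq_Suc' le_Suc_ex)
      then have "delete_nth i ?us = a @ y # x # delete_nth k b"
        "delete_nth i ?vs = a @ x # y # delete_nth k b"
        by (auto simp: delete_nth_def numeral_3_eq_3)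
      then show ?thesis using k simplex_chain_swap[of a y x "delete_nth k b" ws]
        by simp
    qed (auto simp: delete_nth_def)
  qed
  have "(\<Sum>i<length ?us. (-1) ^ i * simplex_chain (delete_nth i ?us) ws) =
        (\<Sum>i<length ?vs. - ((-1) ^ i * simplex_chain (delete_nth i ?vs) ws))"
  proof (rule sum.reindex_bij_witness[of _ ?t ?t])
    fix i
    show "- ((-1) ^ ?t i * simplex_chain (delete_nth (?t i) ?vs) ws) =
          (-1) ^ i * simplex_chain (delete_nth i ?us) ws"
      using main[of "?t i"] by simp
  qed (auto simp: Transposition.transpose_def)
  then show ?thesis
    by (simp add: simplex_boundary_def sum_negf)
qed

definition same_up_to_sign :: "'a list \<Rightarrow> 'a list \<Rightarrow> bool" where
  "same_up_to_sign us vs \<longleftrightarrow>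
     (\<exists>s\<in>{1, -1}. \<forall>ws. simplex_chain us ws = s * simplex_chain vs ws \<and>
                       simplex_boundary us ws = s * simplex_boundary vs ws)"

lemma same_up_to_sign_refl: "same_up_to_sign us us"
  by (auto simp: same_up_to_sign_def)

lemma same_up_to_sign_trans:
  "same_up_to_sign us vs \<Longrightarrow> same_up_to_sign vs ws \<Longrightarrow> same_up_to_sign us ws"
  by (auto simp: same_up_to_sign_def)

lemma same_up_to_sign_swap: "same_up_to_sign (a @ y # x # b) (a @ x # y # b)"
  unfolding same_up_to_sign_def
  using simplex_chain_swap[of a y x b] simplex_boundary_swap[of a y x b]
  by (intro bexI[of _ "-1"] allI conjI) (simp_all only: insert_iff mult_minus1 simp_thms)

lemma same_up_to_sign_move: "same_up_to_sign (p @ a @ x # b) (p @ x # a @ b)"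
proof (induction a arbitrary: p)
  case Nil
  then show ?case by (simp add: same_up_to_sign_refl)
next
  case (Cons y a)
  have "same_up_to_sign (p @ (y # a) @ x # b) (p @ y # x # a @ b)"
    using Cons.IH[of "p @ [y]"] by simp
  then show ?case
    using same_up_to_sign_swap[of p y x "a @ b"] by (auto intro: same_up_to_sign_trans)
qed

lemma same_up_to_sign_mset:
  "mset us = mset vs \<Longrightarrow> same_up_to_sign (p @ us) (p @ vs)"
proof (induction vs arbitrary: us p)
  case Nil
  then show ?case by (simp add: same_up_to_sign_refl)
next
  case (Cons x vs)
  then have "x \<in> set us" by (metis list.set_intros(1) mset_eq_setD)
  then obtain a b where us: "us = a @ x # b" by (auto dest: split_list)
  have "same_up_to_sign ((p @ [x]) @ a @ b) ((p @ [x]) @ vs)"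
    by (rule Cons.IH) (use Cons.prems us in auto)
  then show ?case
    using same_up_to_sign_move[of p a x b] us by (auto intro: same_up_to_sign_trans)
qed

lemma simplex_chain_self:
  assumes "distinct vs"
  shows "simplex_chain vs vs = 1"
proof -
  have "{\<pi>. \<pi> permutes {..<length vs} \<and> permute_list \<pi> vs = vs} = {id}"
  proof (intro equalityI subsetI)
    fix \<pi> assume "\<pi> \<in> {\<pi>. \<pi> permutes {..<length vs} \<and> permute_list \<pi> vs = vs}"
    then have p: "\<pi> permutes {..<length vs}" and e: "permute_list \<pi> vs = vs" by auto
    have "\<pi> i = i" for i
    proof (cases "i < length vs")
      case True
      then have "vs ! \<pi> i = vs ! i" using permute_list_nth[OF p, of i] e by simp
      moreover have "\<pi> i < length vs" using True permutes_in_image[OF p, of i] by simp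
      ultimately show ?thesis using True assms by (simp add: nth_eq_iff_index_eq)
    next
      case False
      then show ?thesis using p by (simp add: permutes_def)
    qed
    then show "\<pi> \<in> {id}" by auto
  qed (auto simp: permutes_id)
  then show ?thesis by (simp add: simplex_chain_def)
qed

lemma simplex_chain_nonzero:
  "simplex_chain vs ws \<noteq> 0 \<Longrightarrow> mset ws = mset vs"
  unfolding simplex_chain_def by (rule ccontr, erule notE, rule sum.neutral) auto

lemma chosen_ordering:
  assumes "finite S"
  shows "distinct (chosen_ordering S)" "set (chosen_ordering S) = S"
proof -
  have "\<exists>vs. distinct vs \<and> set vs = S"
    using finite_distinct_list[OF assms] by blast
  from someI_ex[OF this] show "distinct (chosen_ordering S)" "set (chosen_ordering S) = S"
    by (auto simp: chosen_ordering_def)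
qed

lemma boundary_simplex_chain:
  assumes d: "distinct vs"
  shows "boundary (simplex_chain vs) = simplex_boundary vs"
proof
  fix ws
  let ?us = "chosen_ordering (set vs)"
  have "chain_simplices (simplex_chain vs) = {set vs}"
    using simplex_chain_self[OF d] simplex_chain_nonzero[of vs]
    by (force simp: chain_simplices_def dest: mset_eq_setD)
  moreover have "mset vs = mset ?us"
    using chosen_ordering[of "set vs"] d by (simp add: set_eq_iff_mset_eq_distinct[symmetric])
  then have "same_up_to_sign vs ?us"
    using same_up_to_sign_mset[of vs ?us "[]"] by simp
  moreover have "simplex_chain ?us ?us = 1"
    by (rule simplex_chain_self) (simp add: chosen_ordering)
  ultimately show "boundary (simplex_chain vs) ws = simplex_boundary vs ws"
    by (auto simp: boundary_def same_up_to_sign_def)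
qed

lemma boundary_facet_chain:
  assumes "s = 1 \<or> s = -1" "distinct vs"
  shows "boundary (facet_chain (s, vs)) ws = of_int s * simplex_boundary vs ws"
proof -
  have "chain_simplices (facet_chain (s, vs)) = chain_simplices (simplex_chain vs)"
    using assms by (auto simp: chain_simplices_def facet_chain_def)
  then have "boundary (facet_chain (s, vs)) ws = of_int s * boundary (simplex_chain vs) ws"
    by (simp add: boundary_def facet_chain_def sum_distrib_left mult.assoc)
  then show ?thesis by (simp add: boundary_simplex_chain[OF assms(2)])
qed

lemma simplex_chain_in_chains:
  assumes "distinct vs" "length vs = n + 1" "set vs \<subseteq> V"
  shows "simplex_chain vs \<in> chains n V"
proof -
  have "simplex_chain vs (permute_list \<pi> ws) = of_int (sign \<pi>) * simplex_chain vs ws"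
    if p: "\<pi> permutes {..<length ws}" for \<pi> ws
  proof -
    have m: "mset (permute_list \<pi> ws) = mset ws" using p by simp
    show ?thesis
    proof (cases "mset ws = mset vs")
      case True
      have len: "length ws = length vs" using True by (rule mset_eq_length)
      obtain \<sigma> where s: "\<sigma> permutes {..<length vs}" "permute_list \<sigma> vs = ws"
        using mset_eq_permutation[OF True] by blast
      have dist: "distinct ws" "distinct (permute_list \<pi> ws)"
        using assms(1) s p by auto
      have "simplex_chain ws ws = of_int (sign \<sigma>) * simplex_chain vs ws"
        using simplex_chain_permute_list[OF s(1), of ws] s by simp
      then have 1: "simplex_chain vs ws = of_int (sign \<sigma>)"
        using simplex_chain_self[OF dist(1)] by (cases \<sigma> rule: sign_cases) auto
      have "simplex_chain (permute_list \<pi> ws) (permute_list \<pi> ws) =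
            of_int (sign \<pi>) * simplex_chain ws (permute_list \<pi> ws)"
        by (rule simplex_chain_permute_list[OF p])
      also have "simplex_chain ws (permute_list \<pi> ws) =
            of_int (sign \<sigma>) * simplex_chain vs (permute_list \<pi> ws)"
        using simplex_chain_permute_list[OF s(1), of "permute_list \<pi> ws"] s by simp
      finally show ?thesis
        using simplex_chain_self[OF dist(2)] 1
        by (cases \<sigma> rule: sign_cases; cases \<pi> rule: sign_cases) auto
    next
      case False
      then show ?thesis using simplex_chain_nonzero[of vs ws]
          simplex_chain_nonzero[of vs "permute_list \<pi> ws"] m by fastforce
    qed
  qed
  moreover have "distinct ws \<and> length ws = n + 1 \<and> set ws \<subseteq> V" if "simplex_chain vs ws \<noteq> 0" for ws
    using simplex_chain_nonzero[OF that] assms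
    by (metis mset_eq_imp_distinct_iff mset_eq_length mset_eq_setD)
  ultimately show ?thesis by (simp add: chains_def)
qed

lemma simplex_chain_map:
  assumes "inj f"
  shows "simplex_chain (map f vs) (map f ws) = simplex_chain vs ws"
proof -
  have "\<pi> permutes {..<length (map f vs)} \<and> permute_list \<pi> (map f vs) = map f ws \<longleftrightarrow>
        \<pi> permutes {..<length vs} \<and> permute_list \<pi> vs = ws" for \<pi>
    using assms by (auto simp: permute_list_map inj_map_eq_map)
  then show ?thesis by (simp only: simplex_chain_def length_map)
qed

lemma simplex_chain_map_outside:
  assumes "\<not> set ws \<subseteq> range f"
  shows "simplex_chain (map f vs) ws = 0"
proof (rule ccontr)
  assume "simplex_chain (map f vs) ws \<noteq> 0"
  from mset_eq_setD[OF simplex_chain_nonzero[OF this]] show False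
    using assms by auto
qed

lemma delete_nth_map: "delete_nth i (map f vs) = map f (delete_nth i vs)"
  by (simp add: delete_nth_def take_map drop_map)

lemma simplex_boundary_map:
  assumes "inj f"
  shows "simplex_boundary (map f vs) (map f ws) = simplex_boundary vs ws"
  by (simp add: simplex_boundary_def delete_nth_map simplex_chain_map[OF assms])

lemma simplex_boundary_map_outside:
  assumes "\<not> set ws \<subseteq> range f"
  shows "simplex_boundary (map f vs) ws = 0"
  by (simp add: simplex_boundary_def delete_nth_map simplex_chain_map_outside[OF assms])

lemma sum_boundary_facets_map:
  assumes K: "admissible_complex d K" and f: "inj f"
  shows "(\<Sum>F\<in>map_prod id (map f) ` oriented_facets K. boundary (facet_chain F) ws) = 0"
proof -
  have o: "(s = 1 \<or> s = -1) \<and> distinct vs" if "(s, vs) \<in> oriented_facets K" for s vs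
    using K that by (auto simp: admissible_complex_def)
  have inj: "inj_on (map_prod id (map f)) (oriented_facets K)"
    using f by (auto simp: inj_on_def inj_map_eq_map)
  have "(\<Sum>F\<in>map_prod id (map f) ` oriented_facets K. boundary (facet_chain F) ws) =
        (\<Sum>(s, vs)\<in>oriented_facets K. of_int s * simplex_boundary (map f vs) ws)"
    unfolding sum.reindex[OF inj]
  proof (intro sum.cong refl)
    fix F assume F: "F \<in> oriented_facets K"
    obtain s vs where [simp]: "F = (s, vs)" by (cases F)
    have "distinct (map f vs)"
      using o[of s vs] F inj_on_subset[OF f subset_UNIV] by (simp add: distinct_map)
    then show "((\<lambda>F. boundary (facet_chain F) ws) \<circ> map_prod id (map f)) F =
               (case F of (s, vs) \<Rightarrow> of_int s * simplex_boundary (map f vs) ws)"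
      using o[of s vs] F by (simp add: boundary_facet_chain)
  qed
  also have "\<dots> = 0"
  proof (cases "set ws \<subseteq> range f")
    case True
    then obtain us where us: "ws = map f us"
      by (metis ex_map_conv subset_iff imageE)
    have "(\<Sum>(s, vs)\<in>oriented_facets K. of_int s * simplex_boundary (map f vs) ws) =
          (\<Sum>F\<in>oriented_facets K. boundary (facet_chain F) us)"
    proof (intro sum.cong refl)
      fix F assume F: "F \<in> oriented_facets K"
      obtain s vs where [simp]: "F = (s, vs)" by (cases F)
      show "(case F of (s, vs) \<Rightarrow> of_int s * simplex_boundary (map f vs) ws) =
            boundary (facet_chain F) us"
        using o[of s vs] F by (simp add: us boundary_facet_chain simplex_boundary_map[OF f])
    qed
    then show ?thesis using K by (simp add: admissible_complex_def)
  next
    case False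
    then show ?thesis by (simp add: simplex_boundary_map_outside case_prod_unfold)
  qed
  finally show ?thesis .
qed

lemma admissible_disjoint_union:
  assumes K: "admissible_complex d K" and K': "admissible_complex d K'"
  shows "admissible_complex d (K \<squnion>\<^sub>c K')"
proof -
  let ?U = "K \<squnion>\<^sub>c K'"
  let ?l = "map_prod id (map Inl) ` oriented_facets K"
  let ?r = "map_prod id (map Inr) ` oriented_facets K'"
  have cl: "card (Inl ` S) = card S" and cr: "card (Inr ` T) = card T"
    for S :: "'a set" and T :: "'b set"
    by (auto intro: card_image)
  have fac: "facets d ?U = (`) Inl ` facets d K \<union> (`) Inr ` facets d K'"
    by (auto simp: facets_def disjoint_union_def cl cr)
  have bK: "bij_betw (\<lambda>(s, vs). set vs) (oriented_facets K) (facets d K)"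
    and bK': "bij_betw (\<lambda>(s, vs). set vs) (oriented_facets K') (facets d K')"
    using K K' by (auto simp: admissible_complex_def)
  have fin: "finite (oriented_facets K)" "finite (oriented_facets K')"
    using bij_betw_finite[OF bK] bij_betw_finite[OF bK'] K K'
    by (auto simp: admissible_complex_def facets_def)
  have ne: "vs \<noteq> []" if "(s, vs) \<in> oriented_facets K" for s vs
    using bij_betwE[OF bK] that by (force simp: facets_def)
  have disj: "?l \<inter> ?r = {}"
  proof -
    have False if "(s, vs) \<in> oriented_facets K" "map Inl vs = (map Inr vs' :: ('a + 'b) list)"
      for s vs vs'
      using that ne[of s vs] by (cases vs; cases vs') auto
    then show ?thesis by fastforce
  qed
  have image_complex: "simplicial_complex ((`) f ` X)" if X: "simplicial_complex X"
    for f :: "'c \<Rightarrow> 'a + 'b" and X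
    unfolding simplicial_complex_def
  proof (intro conjI ballI allI impI)
    fix S T assume "S \<in> (`) f ` X" and T: "T \<subseteq> S \<and> T \<noteq> {}"
    then obtain S0 where S0: "S0 \<in> X" "S = f ` S0" by blast
    then obtain T0 where T0: "T0 \<subseteq> S0" "T = f ` T0" using T by (meson subset_imageE)
    then have "T0 \<in> X" using X S0(1) T unfolding simplicial_complex_def by blast
    then show "T \<in> (`) f ` X" using T0(2) by blast
  qed (use X in \<open>auto simp: simplicial_complex_def\<close>)
  have un: "simplicial_complex (X \<union> Y)" if "simplicial_complex X" "simplicial_complex Y"
    for X Y :: "('a + 'b) set set"
    using that unfolding simplicial_complex_def ball_Un by (meson UnI1 UnI2)
  have "simplicial_complex (simplices K)" "simplicial_complex (simplices K')"
    using K K' by (simp_all add: admissible_complex_def)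
  then have "simplicial_complex (simplices ?U)"
    by (simp add: disjoint_union_def un image_complex)
  moreover have "finite (simplices ?U)"
    using K K' by (simp add: admissible_complex_def disjoint_union_def)
  moreover have "\<forall>S\<in>simplices ?U. \<exists>T\<in>facets d ?U. S \<subseteq> T"
  proof
    fix S assume "S \<in> simplices ?U"
    then consider S0 where "S0 \<in> simplices K" "S = Inl ` S0"
      | S0 where "S0 \<in> simplices K'" "S = Inr ` S0"
      by (auto simp: disjoint_union_def)
    then show "\<exists>T\<in>facets d ?U. S \<subseteq> T"
    proof cases
      case 1
      then obtain T where "T \<in> facets d K" "S0 \<subseteq> T" using K by (auto simp: admissible_complex_def)
      then show ?thesis using 1 by (intro bexI[of _ "Inl ` T"]) (auto simp: fac)
    next
      case 2
      then obtain T where "T \<in> facets d K'" "S0 \<subseteq> T" using K' by (auto simp: admissible_complex_def)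
      then show ?thesis using 2 by (intro bexI[of _ "Inr ` T"]) (auto simp: fac)
    qed
  qed
  moreover have "\<forall>(s, vs)\<in>oriented_facets ?U. (s = 1 \<or> s = -1) \<and> distinct vs"
    using K K' by (fastforce simp: admissible_complex_def disjoint_union_def distinct_map)
  moreover have "bij_betw (\<lambda>(s, vs). set vs) (oriented_facets ?U) (facets d ?U)"
  proof -
    have "inj_on (\<lambda>(s, vs). set vs) (?l \<union> ?r)"
    proof (rule inj_onI)
      fix F G assume F: "F \<in> ?l \<union> ?r" and G: "G \<in> ?l \<union> ?r"
        and e: "(\<lambda>(s, vs). set vs) F = (\<lambda>(s, vs). set vs) G"
      have iK: "F0 = G0" if "F0 \<in> oriented_facets K" "G0 \<in> oriented_facets K"
        "set (snd F0) = set (snd G0)" for F0 G0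
        using bij_betw_imp_inj_on[OF bK] that by (auto simp: inj_on_def case_prod_unfold)
      have iK': "F0 = G0" if "F0 \<in> oriented_facets K'" "G0 \<in> oriented_facets K'"
        "set (snd F0) = set (snd G0)" for F0 G0
        using bij_betw_imp_inj_on[OF bK'] that by (auto simp: inj_on_def case_prod_unfold)
      have mixed: "Inl ` set vs \<noteq> (Inr ` set vs' :: ('a + 'b) set)"
        if "(s, vs) \<in> oriented_facets K" for s vs vs'
      proof -
        from ne[OF that] obtain v where "v \<in> set vs" by (cases vs) auto
        then show ?thesis by blast
      qed
      consider F0 G0 where "F0 \<in> oriented_facets K" "G0 \<in> oriented_facets K"
          "F = map_prod id (map Inl) F0" "G = map_prod id (map Inl) G0"
        | F0 G0 where "F0 \<in> oriented_facets K'" "G0 \<in> oriented_facets K'"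
          "F = map_prod id (map Inr) F0" "G = map_prod id (map Inr) G0"
        | F0 G0 where "F0 \<in> oriented_facets K" "G0 \<in> oriented_facets K'"
          "F = map_prod id (map Inl) F0" "G = map_prod id (map Inr) G0"
        | F0 G0 where "F0 \<in> oriented_facets K'" "G0 \<in> oriented_facets K"
          "F = map_prod id (map Inr) F0" "G = map_prod id (map Inl) G0"
        using F G by (elim UnE imageE) metis+
      then show "F = G"
      proof cases
        case 1
        then have "set (snd F0) = set (snd G0)" using e
          by (simp add: case_prod_unfold inj_image_eq_iff)
        then show ?thesis using iK 1 by blast
      next
        case 2
        then have "set (snd F0) = set (snd G0)" using e
          by (simp add: case_prod_unfold inj_image_eq_iff)
        then show ?thesis using iK' 2 by blast
      next
        case 3
        then show ?thesis using e mixed[of "fst F0" "snd F0" "snd G0"]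
          by (simp add: case_prod_unfold)
      next
        case 4
        then show ?thesis using e mixed[of "fst G0" "snd G0" "snd F0"]
          by (simp add: case_prod_unfold)
      qed
    qed
    moreover have "(\<lambda>(s, vs). set vs) ` (?l \<union> ?r) = facets d ?U"
      unfolding fac bij_betw_imp_surj_on[OF bK, symmetric] bij_betw_imp_surj_on[OF bK', symmetric]
      by (simp add: image_Un image_image case_prod_unfold)
    ultimately show ?thesis by (simp add: bij_betw_def disjoint_union_def)
  qed
  moreover have "(\<Sum>F\<in>oriented_facets ?U. boundary (facet_chain F) ws) = 0" for ws
    using fin disj sum_boundary_facets_map[OF K inj_Inl, of ws]
      sum_boundary_facets_map[OF K' inj_Inr, of ws]
    by (simp add: disjoint_union_def sum.union_disjoint)
  ultimately show ?thesis by (simp add: admissible_complex_def)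
qed

end

theory Submission
  imports Defs "HOL-Combinatorics.Multiset_Permutations"
begin

text \<open>
  For the upper bound, optimal fillings of the two complexes are carried over to the disjoint union
  and added (\<open>VQ_disjoint_union_le\<close>).

  For the lower bound in dimension \<open>d \<ge> 1\<close>, take an optimal filling \<open>\<gamma>\<close> of the union
  (\<open>VQ_disjoint_union_ge\<close>). Collapsing all vertices of \<open>K'\<close> to one vertex of \<open>K\<close> sends
  \<open>\<gamma>\<close> to a filling of \<open>K\<close>, because the image of \<open>K'\<close> is degenerate; its norm is at
  most the total weight of those simplices of \<open>\<gamma>\<close> that stay nondegenerate, which have at most
  one vertex in \<open>K'\<close>. Likewise the other collapse gives a filling of \<open>K'\<close> that only uses
  simplices with at most one vertex in \<open>K\<close>. A simplex with \<open>d + 2 \<ge> 3\<close> vertices cannot be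
  of both kinds, so the two norms add up to at most the norm of \<open>\<gamma>\<close>.

  In dimension 0 an edge may survive both collapses. There \<open>VQ 0 K\<close> is half the number of
  vertices (\<open>VQ_dim_0\<close>): every vertex has coefficient 1 or -1 in \<open>K\<close> and the boundary of an
  edge has norm 2, which is a lower bound; the mean of the cones over \<open>K\<close>, taken over all
  apices, attains it. Additivity is then a count of vertices.

  Since \<open>VQ\<close> is a least element in the rationals, one also has to know that the minimum is
  attained (\<open>VQ_minimum\<close>). Fillings exist, the mean cone being one, and a sum of absolute values
  attains its minimum on an affine subspace over any ordered field (\<open>l1_min_attained\<close>): a point
  whose support contains that of another point can be moved along the line through both, in the
  direction in which the sum does not increase, until a coordinate vanishes. So only points of
  minimal support matter, and there is at most one of them for each support.

  Sums over unordered simplices are replaced throughout by sums over ordered ones: the norm of an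
  \<open>n\<close>-chain is \<open>1 / (n + 1)!\<close> times the sum of \<open>\<bar>c us\<bar>\<close> over all ordered simplices \<open>us\<close>
  (\<open>sum_ordered_simplices_abs\<close>), and \<open>boundary c ws\<close> is the sum of \<open>c (v # ws)\<close> over
  all vertices \<open>v\<close> (\<open>boundary_eq_sum_Cons\<close>).
\<close>

section \<open>Alternating functions\<close>

text \<open>The second condition in the definition of \<open>chains\<close>: reordering multiplies by the sign.\<close>

definition alternating :: "'a chain \<Rightarrow> bool" where
  "alternating c \<longleftrightarrow>
     (\<forall>vs \<pi>. \<pi> permutes {..<length vs} \<longrightarrow> c (permute_list \<pi> vs) = of_int (sign \<pi>) * c vs)"

lemma chains_alt_def:
  "c \<in> chains n V \<longleftrightarrow> alternating c \<and>
     (\<forall>vs. c vs \<noteq> 0 \<longrightarrow> distinct vs \<and> length vs = n + 1 \<and> set vs \<subseteq> V)"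
  by (auto simp: chains_def alternating_def)

text \<open>Adjacent transpositions generate all rearrangements of a list, also with repeated entries.\<close>

lemma swap_invariant_mset:
  assumes swap: "\<And>a x y b. g (a @ y # x # b) = g (a @ x # y # b)"
  shows "mset us = mset vs \<Longrightarrow> g us = g vs"
proof -
  have move: "g (p @ a @ x # b) = g (p @ x # a @ b)" for p a x b
  proof (induction a arbitrary: p)
    case (Cons y a)
    have "g (p @ (y # a) @ x # b) = g (p @ y # x # a @ b)"
      using Cons.IH[of "p @ [y]"] by simp
    then show ?case using swap[of p y x "a @ b"] by simp
  qed simp
  have "mset us = mset vs \<Longrightarrow> g (p @ us) = g (p @ vs)" for p
  proof (induction vs arbitrary: us p)
    case (Cons x vs)
    then have "x \<in> set us" by (metis list.set_intros(1) mset_eq_setD)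
    then obtain a b where us: "us = a @ x # b" by (auto dest: split_list)
    have "g ((p @ [x]) @ a @ b) = g ((p @ [x]) @ vs)"
      by (rule Cons.IH) (use Cons.prems us in auto)
    then show ?case using move[of p a x b] us by simp
  qed simp
  from this[of "[]"] show "mset us = mset vs \<Longrightarrow> g us = g vs" by simp
qed

lemma alternating_swap:
  assumes "alternating c"
  shows "c (a @ y # x # b) = - c (a @ x # y # b)"
proof -
  let ?t = "Transposition.transpose (length a) (Suc (length a))"
  have p: "?t permutes {..<length (a @ x # y # b)}"
    by (rule permutes_swap_id) auto
  have "permute_list ?t (a @ x # y # b) = a @ y # x # b"
  proof (rule nth_equalityI)
    fix i assume "i < length (permute_list ?t (a @ x # y # b))"
    then show "permute_list ?t (a @ x # y # b) ! i = (a @ y # x # b) ! i"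
      by (subst permute_list_nth[OF p])
        (auto simp: Transposition.transpose_def nth_append nth_Cons split: nat.splits)
  qed simp
  moreover have "c (permute_list ?t (a @ x # y # b)) = of_int (sign ?t) * c (a @ x # y # b)"
    using assms p unfolding alternating_def by blast
  ultimately show ?thesis by (simp add: sign_swap_id)
qed

lemma alternatingI_swap:
  fixes c :: "'a chain"
  assumes swap: "\<And>a x y b. c (a @ y # x # b) = - c (a @ x # y # b)"
  shows "alternating c"
  unfolding alternating_def
proof (intro allI impI)
  fix vs :: "'a list" and \<pi> assume p: "\<pi> permutes {..<length vs}"
  let ?n = "[0..<length vs]"
  \<comment> \<open>Passing to positions makes the list distinct even if \<open>vs\<close> is not; the factor
      \<open>simplex_chain us ?n\<close> is the sign of the rearrangement \<open>us\<close> of \<open>?n\<close>.\<close>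
  define g where "g us = c (map ((!) vs) us) * simplex_chain us ?n" for us :: "nat list"
  have p': "\<pi> permutes {..<length ?n}" using p by simp
  have "g (permute_list \<pi> ?n) = g ?n"
  proof (rule swap_invariant_mset)
    show "g (a @ y # x # b) = g (a @ x # y # b)" for a x y b
      using swap[of "map ((!) vs) a" "vs ! y" "vs ! x" "map ((!) vs) b"]
        simplex_chain_swap[of a y x b] by (simp add: g_def)
  qed (use p' in simp)
  moreover have "g (permute_list \<pi> ?n) = c (permute_list \<pi> vs) * of_int (sign \<pi>)"
  proof -
    have "map ((!) vs) (permute_list \<pi> ?n) = permute_list \<pi> vs"
      unfolding permute_list_map[OF p', symmetric] map_nth ..
    moreover have "simplex_chain (permute_list \<pi> ?n) ?n = of_int (sign \<pi>)"
      unfolding simplex_chain_permute_list[OF p'] by (subst simplex_chain_self) simp_all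
    ultimately show ?thesis by (simp only: g_def)
  qed
  moreover have "g ?n = c vs"
    unfolding g_def map_nth by (subst simplex_chain_self) simp_all
  ultimately have "c (permute_list \<pi> vs) * of_int (sign \<pi>) = c vs" by simp
  then show "c (permute_list \<pi> vs) = of_int (sign \<pi>) * c vs"
    by (cases \<pi> rule: sign_cases) auto
qed

lemma alternating_abs_mset:
  assumes "alternating c" "mset us = mset vs"
  shows "\<bar>c us\<bar> = \<bar>c vs\<bar>"
proof (rule swap_invariant_mset[of "\<lambda>us. \<bar>c us\<bar>"])
  show "\<bar>c (a @ y # x # b)\<bar> = \<bar>c (a @ x # y # b)\<bar>" for a x y b
    using alternating_swap[OF assms(1), of a y x b] by simp
qed fact

lemma alternating_not_distinct:
  assumes c: "alternating c" and "\<not> distinct us"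
  shows "c us = 0"
proof -
  obtain p q r x where us: "us = p @ [x] @ q @ [x] @ r"
    using not_distinct_decomp[OF assms(2)] by blast
  have "\<bar>c us\<bar> = \<bar>c ([] @ x # x # p @ q @ r)\<bar>"
    by (rule alternating_abs_mset[OF c]) (simp add: us)
  also have "\<dots> = 0" using alternating_swap[OF c, of "[]" x x "p @ q @ r"] by simp
  finally show ?thesis by simp
qed

lemma chainsI:
  assumes "alternating c" "\<And>us. c us \<noteq> 0 \<Longrightarrow> length us = n + 1 \<and> set us \<subseteq> V"
  shows "c \<in> chains n V"
  using assms alternating_not_distinct[OF assms(1)] by (fastforce simp: chains_alt_def)

lemma chains_add:
  assumes "c \<in> chains n V" "c' \<in> chains n V"
  shows "(\<lambda>us. c us + c' us) \<in> chains n V"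
proof (rule chainsI)
  show "alternating (\<lambda>us. c us + c' us)"
    using assms by (simp add: chains_alt_def alternating_def distrib_left)
  fix us assume "c us + c' us \<noteq> 0"
  then have "c us \<noteq> 0 \<or> c' us \<noteq> 0" by auto
  then show "length us = n + 1 \<and> set us \<subseteq> V"
    using assms unfolding chains_alt_def by blast
qed

lemma chains_scale:
  "c \<in> chains n V \<Longrightarrow> (\<lambda>us. t * c us) \<in> chains n V"
  by (auto simp: chains_def)

lemma chains_sum:
  "(\<And>i. i \<in> I \<Longrightarrow> c i \<in> chains n V) \<Longrightarrow> (\<lambda>us. \<Sum>i\<in>I. c i us) \<in> chains n V"
proof (induction I rule: infinite_finite_induct)
  case (insert i I)
  then show ?case using chains_add[of "c i" n V "\<lambda>us. \<Sum>i\<in>I. c i us"] by simp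
qed (auto simp: chains_def)

lemma chains_mono: "V \<subseteq> W \<Longrightarrow> chains n V \<subseteq> chains n W"
  by (fastforce simp: chains_def)

lemma simplex_chain_commute: "simplex_chain vs ws = simplex_chain ws vs"
proof -
  have le: "permute_list (inv \<pi>) ws = vs"
    if p: "\<pi> permutes {..<length vs}" and e: "permute_list \<pi> vs = ws" for \<pi> and vs ws :: "'a list"
  proof -
    have "permute_list (\<pi> \<circ> inv \<pi>) vs = permute_list (inv \<pi>) (permute_list \<pi> vs)"
      by (rule permute_list_compose) (use p permutes_inv in auto)
    then show ?thesis using e permutes_inv_o(1)[OF p] by simp
  qed
  show ?thesis
    unfolding simplex_chain_def
  proof (rule sum.reindex_bij_witness[of _ inv inv])
    fix \<pi> assume "\<pi> \<in> {\<pi>. \<pi> permutes {..<length vs} \<and> permute_list \<pi> vs = ws}"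
    then have p: "\<pi> permutes {..<length vs}" and e: "permute_list \<pi> vs = ws" by auto
    show "inv (inv \<pi>) = \<pi>" using p by (rule permutes_inv_inv)
    have "length ws = length vs" using e by auto
    then show "inv \<pi> \<in> {\<pi>. \<pi> permutes {..<length ws} \<and> permute_list \<pi> ws = vs}"
      using le[OF p e] permutes_inv[OF p] by simp
    show "of_int (sign (inv \<pi>)) = (of_int (sign \<pi>) :: rat)"
      using p by (simp add: sign_inverse permutes_imp_permutation[OF finite_lessThan])
  next
    fix \<pi> assume "\<pi> \<in> {\<pi>. \<pi> permutes {..<length ws} \<and> permute_list \<pi> ws = vs}"
    then have p: "\<pi> permutes {..<length ws}" and e: "permute_list \<pi> ws = vs" by auto
    show "inv (inv \<pi>) = \<pi>" using p by (rule permutes_inv_inv)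
    have "length vs = length ws" using e by auto
    then show "inv \<pi> \<in> {\<pi>. \<pi> permutes {..<length vs} \<and> permute_list \<pi> vs = ws}"
      using le[OF p e] permutes_inv[OF p] by simp
  qed
qed

section \<open>Norm and boundary as sums over ordered simplices\<close>

abbreviation ordered_simplices :: "nat \<Rightarrow> 'a set \<Rightarrow> 'a list set" where
  "ordered_simplices n V \<equiv> {us. set us \<subseteq> V \<and> length us = n + 1}"

lemma chain_simplex_props:
  assumes c: "c \<in> chains n V" and "finite V" and "S \<in> chain_simplices c"
  shows "S \<subseteq> V" "finite S" "card S = n + 1"
proof -
  obtain us where "c us \<noteq> 0" "S = set us" using assms(3) by (auto simp: chain_simplices_def)
  then show "S \<subseteq> V" "finite S" "card S = n + 1"
    using c by (auto simp: chains_def distinct_card)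
qed

lemma finite_chain_simplices:
  assumes "c \<in> chains n V" "finite V"
  shows "finite (chain_simplices c)"
  by (rule finite_subset[of _ "Pow V"]) (use chain_simplex_props[OF assms] assms(2) in auto)

lemma sum_ordered_simplices_abs:
  assumes c: "c \<in> chains n V" and V: "finite V"
  shows "(\<Sum>us\<in>ordered_simplices n V. \<bar>c us\<bar>) = fact (n + 1) * chain_norm c"
proof -
  let ?T = "\<lambda>S. permutations_of_set S"
  have alt: "alternating c" using c by (simp add: chains_alt_def)
  have "(\<Sum>us\<in>ordered_simplices n V. \<bar>c us\<bar>) =
        (\<Sum>us\<in>(\<Union>S\<in>chain_simplices c. ?T S). \<bar>c us\<bar>)"
  proof (rule sum.mono_neutral_right)
    show "finite (ordered_simplices n V)" using V by (rule finite_lists_length_eq)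
    show "(\<Union>S\<in>chain_simplices c. ?T S) \<subseteq> ordered_simplices n V"
      using chain_simplex_props[OF c V]
      by (fastforce simp: permutations_of_set_def distinct_card[symmetric])
    show "\<forall>us\<in>ordered_simplices n V - (\<Union>S\<in>chain_simplices c. ?T S). \<bar>c us\<bar> = 0"
      using c by (auto simp: chain_simplices_def permutations_of_set_def chains_def)
  qed
  also have "\<dots> = (\<Sum>S\<in>chain_simplices c. \<Sum>us\<in>?T S. \<bar>c us\<bar>)"
    using finite_chain_simplices[OF c V]
    by (intro sum.UNION_disjoint) (auto dest: permutations_of_setD)
  also have "\<dots> = (\<Sum>S\<in>chain_simplices c. fact (n + 1) * \<bar>c (chosen_ordering S)\<bar>)"
  proof (intro sum.cong refl)
    fix S assume S: "S \<in> chain_simplices c"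
    note pr = chain_simplex_props[OF c V S]
    have "\<bar>c us\<bar> = \<bar>c (chosen_ordering S)\<bar>" if "us \<in> ?T S" for us
      by (rule alternating_abs_mset[OF alt])
        (use that chosen_ordering[OF pr(2)] in
          \<open>auto simp: permutations_of_set_def set_eq_iff_mset_eq_distinct[symmetric]\<close>)
    then have "(\<Sum>us\<in>?T S. \<bar>c us\<bar>) = (\<Sum>us\<in>?T S. \<bar>c (chosen_ordering S)\<bar>)"
      by simp
    also have "\<dots> = fact (n + 1) * \<bar>c (chosen_ordering S)\<bar>"
      using pr by (simp add: algebra_simps)
    finally show "(\<Sum>us\<in>?T S. \<bar>c us\<bar>) = fact (n + 1) * \<bar>c (chosen_ordering S)\<bar>" .
  qed
  finally show ?thesis by (simp add: chain_norm_def sum_distrib_left)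
qed

lemma simplex_boundary_Cons:
  "simplex_boundary (v # ws) us =
     simplex_chain ws us - (\<Sum>i<length ws. (-1) ^ i * simplex_chain (v # delete_nth i ws) us)"
proof -
  have "{..<length (v # ws)} = insert 0 (Suc ` {..<length ws})"
    by (simp add: lessThan_Suc_eq_insert_0)
  then show ?thesis
    by (simp add: simplex_boundary_def sum.reindex delete_nth_def sum_negf o_def)
qed

lemma mset_delete_nth: "i < length us \<Longrightarrow> mset us = add_mset (us ! i) (mset (delete_nth i us))"
  by (metis delete_nth_def id_take_nth_drop mset.simps(2) mset_append union_mset_add_mset_right)

lemma simplex_boundary_nonzero:
  assumes "simplex_boundary vs ws \<noteq> 0"
  shows "\<exists>v. mset vs = add_mset v (mset ws)"
proof -
  obtain i where "i < length vs" "simplex_chain (delete_nth i vs) ws \<noteq> 0"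
    using assms unfolding simplex_boundary_def
    by (metis (no_types, lifting) lessThan_iff mult_zero_right sum.neutral)
  then show ?thesis using simplex_chain_nonzero[of "delete_nth i vs" ws] mset_delete_nth[of i vs]
    by auto
qed

text \<open>
  Among the faces of \<open>[v, w\<^sub>0, \<dots>, w\<^sub>n]\<close> only the one opposite to \<open>v\<close> contributes to
  \<open>[w\<^sub>0, \<dots>, w\<^sub>n]\<close>, and it does so with coefficient 1.
\<close>

lemma boundary_eq_sum_Cons:
  assumes c: "c \<in> chains n V" and V: "finite V"
  shows "boundary c ws = (\<Sum>v\<in>V. c (v # ws))"
proof -
  have alt: "alternating c" using c by (simp add: chains_alt_def)
  let ?A = "\<lambda>S. {v\<in>V. c (v # ws) \<noteq> 0 \<and> set (v # ws) = S}"
  have S: "c (chosen_ordering S) * simplex_boundary (chosen_ordering S) ws =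
      (\<Sum>v\<in>?A S. c (v # ws))"
    if S: "S \<in> chain_simplices c" for S
  proof -
    note pr = chain_simplex_props[OF c V S]
    let ?o = "chosen_ordering S"
    \<comment> \<open>Both factors change sign under a swap, so the chosen ordering of \<open>S\<close> may be replaced by
        one of the form \<open>v # ws\<close>.\<close>
    define g where "g us = c us * simplex_boundary us ws" for us
    have ginv: "g us = g vs" if "mset us = mset vs" for us vs
    proof (rule swap_invariant_mset[OF _ that])
      show "g (a @ y # x # b) = g (a @ x # y # b)" for a x y b
        using alternating_swap[OF alt, of a y x b] simplex_boundary_swap[of a y x b ws]
        by (simp add: g_def)
    qed
    have gv: "g ?o = c (v # ws)" if v: "mset ?o = add_mset v (mset ws)" for v
    proof -
      have dist: "distinct (v # ws)"
        using v chosen_ordering(1)[OF pr(2)] by (metis mset.simps(2) mset_eq_imp_distinct_iff)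
      have "simplex_chain (v # us) ws = 0" for us
      proof (rule ccontr)
        assume "simplex_chain (v # us) ws \<noteq> 0"
        then have "set ws = set (v # us)" by (intro mset_eq_setD simplex_chain_nonzero)
        then show False using dist by auto
      qed
      then have "simplex_boundary (v # ws) ws = 1"
        using dist by (simp add: simplex_boundary_Cons simplex_chain_self)
      then show ?thesis using ginv[of ?o "v # ws"] v by (simp add: g_def)
    qed
    have ex: "mset ?o = add_mset v (mset ws)" if "v \<in> ?A S" for v
    proof -
      have "distinct (v # ws)" "set (v # ws) = S" using that c by (auto simp: chains_def)
      then have "mset ?o = mset (v # ws)"
        using chosen_ordering[OF pr(2)] set_eq_iff_mset_eq_distinct[of ?o "v # ws"] by blast
      then show ?thesis by simp
    qed
    show ?thesis
    proof (cases "?A S = {}")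
      case True
      have "g ?o = 0"
      proof (rule ccontr)
        assume nz: "g ?o \<noteq> 0"
        then obtain v where v: "mset ?o = add_mset v (mset ws)"
          using simplex_boundary_nonzero[of ?o ws] by (auto simp: g_def)
        then have "set (v # ws) = S"
          using chosen_ordering(2)[OF pr(2)] by (metis mset.simps(2) mset_eq_setD)
        then have "v \<in> ?A S" using pr(1) gv[OF v] nz by auto
        then show False using True by blast
      qed
      then show ?thesis unfolding True by (simp add: g_def)
    next
      case False
      then obtain v where v: "v \<in> ?A S" by blast
      have "v' = v" if "v' \<in> ?A S" for v' using ex[OF v] ex[OF that] by simp
      then have "?A S = {v}" using v by blast
      then have "(\<Sum>v\<in>?A S. c (v # ws)) = c (v # ws)" by simp
      then show ?thesis using gv[OF ex[OF v]] by (simp add: g_def)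
    qed
  qed
  have "(\<Sum>v\<in>V. c (v # ws)) = (\<Sum>v\<in>(\<Union>S\<in>chain_simplices c. ?A S). c (v # ws))"
    by (rule sum.mono_neutral_right) (use V in \<open>auto simp: chain_simplices_def\<close>)
  also have "\<dots> = (\<Sum>S\<in>chain_simplices c. \<Sum>v\<in>?A S. c (v # ws))"
    by (rule sum.UNION_disjoint) (use finite_chain_simplices[OF c V] V in auto)
  finally show ?thesis by (simp add: boundary_def S)
qed

section \<open>Push-forward of chains along vertex maps\<close>

text \<open>
  The chain map induced by \<open>f\<close> on chains over the finite vertex set \<open>U\<close>. Simplices on which
  \<open>f\<close> is not injective are sent to 0; this is not part of the definition but a consequence of
  the image being alternating.
\<close>

definition push :: "'a set \<Rightarrow> ('a \<Rightarrow> 'b) \<Rightarrow> 'a chain \<Rightarrow> 'b chain" where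
  "push U f c ws = (\<Sum>us | set us \<subseteq> U \<and> map f us = ws. c us)"

lemma finite_map_fibre: "finite U \<Longrightarrow> finite {us. set us \<subseteq> U \<and> map f us = ws}"
  by (rule finite_subset[OF _ finite_lists_length_eq[of U "length ws"]]) auto

lemma alternating_push:
  fixes f :: "'a \<Rightarrow> 'b"
  assumes c: "alternating c"
  shows "alternating (push U f c)"
  unfolding alternating_def
proof (intro allI impI)
  fix ws :: "'b list" and \<pi> assume p: "\<pi> permutes {..<length ws}"
  have i: "inv \<pi> permutes {..<length ws}" using p by (rule permutes_inv)
  have cancel: "permute_list \<pi> (permute_list (inv \<pi>) us) = us"
    "permute_list (inv \<pi>) (permute_list \<pi> us) = us"
    if "length us = length ws" for us :: "'a list"
    using permute_list_compose[of \<pi> us "inv \<pi>"] permute_list_compose[of "inv \<pi>" us \<pi>] p i that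
    by (simp_all only: permutes_inv_o[OF p] permute_list_id)
  have "push U f c (permute_list \<pi> ws) =
      (\<Sum>us | set us \<subseteq> U \<and> map f us = ws. of_int (sign \<pi>) * c us)"
    unfolding push_def
  proof (rule sum.reindex_bij_witness[of _ "permute_list \<pi>" "permute_list (inv \<pi>)"])
    fix us assume "us \<in> {us. set us \<subseteq> U \<and> map f us = permute_list \<pi> ws}"
    then have us: "set us \<subseteq> U" "map f us = permute_list \<pi> ws" by auto
    then have len: "length us = length ws" by (metis length_map length_permute_list)
    show e: "permute_list \<pi> (permute_list (inv \<pi>) us) = us" using cancel(1) len by blast
    have "map f (permute_list (inv \<pi>) us) = permute_list (inv \<pi>) (permute_list \<pi> ws)"
      using permute_list_map[of "inv \<pi>" us f] i len us(2) by simp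
    also have "\<dots> = ws" using permute_list_compose[OF i, of \<pi>]
      by (simp only: permutes_inv_o[OF p] permute_list_id)
    finally show "permute_list (inv \<pi>) us \<in> {us. set us \<subseteq> U \<and> map f us = ws}"
      using us(1) i len by simp
    have "c (permute_list \<pi> (permute_list (inv \<pi>) us)) =
        of_int (sign \<pi>) * c (permute_list (inv \<pi>) us)"
      using c p len unfolding alternating_def by (metis length_permute_list)
    then show "of_int (sign \<pi>) * c (permute_list (inv \<pi>) us) = c us" by (simp add: e)
  next
    fix us assume "us \<in> {us. set us \<subseteq> U \<and> map f us = ws}"
    then have us: "set us \<subseteq> U" "map f us = ws" by auto
    then have len: "length us = length ws" by auto
    show "permute_list (inv \<pi>) (permute_list \<pi> us) = us" using cancel(2) len by blast
    show "permute_list \<pi> us \<in> {us. set us \<subseteq> U \<and> map f us = permute_list \<pi> ws}"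
      using permute_list_map[of \<pi> us f] us p len by simp
  qed
  then show "push U f c (permute_list \<pi> ws) = of_int (sign \<pi>) * push U f c ws"
    by (simp add: push_def sum_distrib_left)
qed

lemma push_nonzero:
  assumes "push U f c ws \<noteq> 0"
  obtains us where "set us \<subseteq> U" "map f us = ws" "c us \<noteq> 0"
  using assms unfolding push_def by (metis (mono_tags, lifting) mem_Collect_eq sum.neutral)

lemma push_in_chains:
  assumes "c \<in> chains n U" "f ` U \<subseteq> V"
  shows "push U f c \<in> chains n V"
proof (rule chainsI)
  show "alternating (push U f c)"
    using assms by (simp add: alternating_push chains_alt_def)
  fix ws assume "push U f c ws \<noteq> 0"
  then obtain us where "set us \<subseteq> U" "map f us = ws" "c us \<noteq> 0" by (rule push_nonzero)
  then show "length ws = n + 1 \<and> set ws \<subseteq> V"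
    using assms unfolding chains_def by (auto simp: image_subset_iff subset_iff)
qed

lemma push_add: "push U f (\<lambda>us. c us + c' us) ws = push U f c ws + push U f c' ws"
  by (simp add: push_def sum.distrib)

lemma push_sum: "push U f (\<lambda>us. \<Sum>i\<in>I. c i us) ws = (\<Sum>i\<in>I. push U f (c i) ws)"
  unfolding push_def by (rule sum.swap)

lemma push_scale: "push U f (\<lambda>us. t * c us) ws = t * push U f c ws"
  by (simp add: push_def sum_distrib_left)

lemma push_push:
  assumes U: "finite U" and W: "finite W" and g: "g ` U \<subseteq> W"
  shows "push W f (push U g c) = push U (f \<circ> g) c"
proof
  fix ws
  let ?A = "\<lambda>vs. {us. set us \<subseteq> U \<and> map g us = vs}"
  let ?B = "{vs. set vs \<subseteq> W \<and> map f vs = ws}"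
  have "push W f (push U g c) ws = (\<Sum>us\<in>(\<Union>vs\<in>?B. ?A vs). c us)"
    unfolding push_def
    by (rule sum.UNION_disjoint[symmetric]) (use finite_map_fibre[OF U] finite_map_fibre[OF W] in auto)
  also have "(\<Union>vs\<in>?B. ?A vs) = {us. set us \<subseteq> U \<and> map (f \<circ> g) us = ws}"
    using g by (auto simp: image_subset_iff subset_iff)
  finally show "push W f (push U g c) ws = push U (f \<circ> g) c ws" by (simp add: push_def)
qed

lemma push_identity:
  assumes c: "c \<in> chains n U" and f: "\<And>u. u \<in> U \<Longrightarrow> f u = u"
  shows "push U f c = c"
proof
  fix ws
  have "{us. set us \<subseteq> U \<and> map f us = ws} = (if set ws \<subseteq> U then {ws} else {})"
  proof -
    have "map f us = us" if "set us \<subseteq> U" for us using that f by (intro map_idI) auto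
    then show ?thesis by auto
  qed
  then show "push U f c ws = c ws" using c by (auto simp: push_def chains_def)
qed

lemma push_simplex_chain:
  assumes U: "finite U" and vs: "set vs \<subseteq> U"
  shows "push U f (simplex_chain vs) ws = simplex_chain (map f vs) ws"
proof -
  let ?P = "\<lambda>us. {\<pi>. \<pi> permutes {..<length vs} \<and> permute_list \<pi> vs = us}"
  let ?A = "{us. set us \<subseteq> U \<and> map f us = ws}"
  have "push U f (simplex_chain vs) ws = (\<Sum>us\<in>?A. \<Sum>\<pi>\<in>?P us. of_int (sign \<pi>))"
    by (simp add: push_def simplex_chain_def)
  also have "\<dots> = (\<Sum>\<pi>\<in>(\<Union>us\<in>?A. ?P us). of_int (sign \<pi>))"
    by (rule sum.UNION_disjoint[symmetric])
      (use finite_map_fibre[OF U] finite_permutations[of "{..<length vs}"] in auto)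
  also have "(\<Union>us\<in>?A. ?P us) =
      {\<pi>. \<pi> permutes {..<length (map f vs)} \<and> permute_list \<pi> (map f vs) = ws}"
    using vs by (auto simp: permute_list_map)
  finally show ?thesis by (simp only: simplex_chain_def[of "map f vs"])
qed

lemma boundary_push:
  assumes c: "c \<in> chains n U" and U: "finite U" and V: "finite V" and f: "f ` U \<subseteq> V"
  shows "boundary (push U f c) = push U f (boundary c)"
proof
  fix ws
  let ?A = "\<lambda>ws. {us. set us \<subseteq> U \<and> map f us = ws}"
  have "boundary (push U f c) ws = (\<Sum>v\<in>V. push U f c (v # ws))"
    by (rule boundary_eq_sum_Cons[OF push_in_chains[OF c f] V])
  also have "\<dots> = (\<Sum>us\<in>(\<Union>v\<in>V. ?A (v # ws)). c us)"
    unfolding push_def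
    by (rule sum.UNION_disjoint[symmetric]) (use V finite_map_fibre[OF U] in auto)
  also have "(\<Union>v\<in>V. ?A (v # ws)) = (\<lambda>(us, u). u # us) ` (?A ws \<times> U)"
    using f by (force simp: map_eq_Cons_conv)
  also have "(\<Sum>us\<in>(\<lambda>(us, u). u # us) ` (?A ws \<times> U). c us) = (\<Sum>(us, u)\<in>?A ws \<times> U. c (u # us))"
    by (subst sum.reindex) (auto simp: inj_on_def intro!: sum.cong)
  also have "\<dots> = (\<Sum>us\<in>?A ws. \<Sum>u\<in>U. c (u # us))"
    by (rule sum.cartesian_product[symmetric])
  also have "\<dots> = push U f (boundary c) ws"
    by (simp add: push_def boundary_eq_sum_Cons[OF c U])
  finally show "boundary (push U f c) ws = push U f (boundary c) ws" .
qed

text \<open>Only simplices that stay nondegenerate contribute to the norm of the image.\<close>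

lemma sum_abs_push_le:
  assumes c: "c \<in> chains n U" and U: "finite U" and V: "finite V" and f: "f ` U \<subseteq> V"
  shows "(\<Sum>ws\<in>ordered_simplices n V. \<bar>push U f c ws\<bar>)
      \<le> (\<Sum>us | us \<in> ordered_simplices n U \<and> distinct (map f us). \<bar>c us\<bar>)"
proof -
  let ?A = "\<lambda>ws. {us. set us \<subseteq> U \<and> map f us = ws}"
  let ?D = "{ws \<in> ordered_simplices n V. distinct ws}"
  have fin: "finite (ordered_simplices n V)" using V by (rule finite_lists_length_eq)
  have finU: "finite (ordered_simplices n U)" using U by (rule finite_lists_length_eq)
  have "(\<Sum>ws\<in>ordered_simplices n V. \<bar>push U f c ws\<bar>) = (\<Sum>ws\<in>?D. \<bar>push U f c ws\<bar>)"
    by (rule sum.mono_neutral_right)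
      (use fin push_in_chains[OF c f] in \<open>auto simp: chains_def\<close>)
  also have "\<dots> \<le> (\<Sum>ws\<in>?D. \<Sum>us\<in>?A ws. \<bar>c us\<bar>)"
    unfolding push_def by (intro sum_mono sum_abs)
  also have "\<dots> = (\<Sum>us\<in>(\<Union>ws\<in>?D. ?A ws). \<bar>c us\<bar>)"
    by (rule sum.UNION_disjoint[symmetric])
      (use finite_map_fibre[OF U] finite_subset[OF _ fin, of ?D] in auto)
  also have "\<dots> \<le> (\<Sum>us | us \<in> ordered_simplices n U \<and> distinct (map f us). \<bar>c us\<bar>)"
    by (rule sum_mono2[OF finite_subset[OF _ finU]]) auto
  finally show ?thesis .
qed

lemma chain_norm_push_le:
  assumes c: "c \<in> chains n U" and U: "finite U" and V: "finite V" and f: "f ` U \<subseteq> V"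
  shows "chain_norm (push U f c) \<le> chain_norm c"
proof -
  have "fact (n + 1) * chain_norm (push U f c) = (\<Sum>ws\<in>ordered_simplices n V. \<bar>push U f c ws\<bar>)"
    by (rule sum_ordered_simplices_abs[symmetric, OF push_in_chains[OF c f] V])
  also have "\<dots> \<le> (\<Sum>us | us \<in> ordered_simplices n U \<and> distinct (map f us). \<bar>c us\<bar>)"
    by (rule sum_abs_push_le[OF c U V f])
  also have "\<dots> \<le> (\<Sum>us\<in>ordered_simplices n U. \<bar>c us\<bar>)"
    by (rule sum_mono2) (use finite_lists_length_eq[OF U] in auto)
  also have "\<dots> = fact (n + 1) * chain_norm c"
    by (rule sum_ordered_simplices_abs[OF c U])
  finally show ?thesis by (simp only: mult_le_cancel_left_pos[OF fact_gt_zero])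
qed

section \<open>Minima of the absolute sum on affine subspaces\<close>

text \<open>
  From \<open>x\<close> one can move in direction \<open>z\<close>, supported inside the support of \<open>x\<close>, until a
  coordinate vanishes, without increasing the absolute sum.
\<close>

lemma l1_shrink_support:
  fixes x z :: "'i \<Rightarrow> 'f::linordered_field"
  assumes I: "finite I" and supp: "\<And>i. i \<in> I \<Longrightarrow> x i = 0 \<Longrightarrow> z i = 0"
    and nz: "\<exists>i\<in>I. z i \<noteq> 0"
  shows "\<exists>t. (\<Sum>i\<in>I. \<bar>x i + t * z i\<bar>) \<le> (\<Sum>i\<in>I. \<bar>x i\<bar>) \<and>
             (\<exists>k\<in>I. x k \<noteq> 0 \<and> x k + t * z k = 0)"
proof -
  have main: "\<exists>t. (\<Sum>i\<in>I. \<bar>x i + t * z i\<bar>) \<le> (\<Sum>i\<in>I. \<bar>x i\<bar>) \<and>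
             (\<exists>k\<in>I. x k \<noteq> 0 \<and> x k + t * z k = 0)"
    if supp: "\<And>i. i \<in> I \<Longrightarrow> x i = 0 \<Longrightarrow> z i = 0" and nz: "\<exists>i\<in>I. z i \<noteq> 0"
      and neg: "(\<Sum>i\<in>I. sgn (x i) * z i) \<le> 0" for z
  proof -
    let ?J = "{i\<in>I. sgn (x i) * z i < 0}"
    have "?J \<noteq> {}"
    proof
      assume "?J = {}"
      then have nn: "\<And>i. i \<in> I \<Longrightarrow> 0 \<le> sgn (x i) * z i" by force
      then have "(\<Sum>i\<in>I. sgn (x i) * z i) = 0" using neg by (meson antisym sum_nonneg)
      then have "\<forall>i\<in>I. sgn (x i) * z i = 0"
        using sum_nonneg_eq_0_iff[OF I, of "\<lambda>i. sgn (x i) * z i"] nn by blast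
      then show False using nz supp by (metis mult_eq_0_iff sgn_eq_0_iff)
    qed
    \<comment> \<open>The first time at which a coordinate vanishes; until then all signs are preserved and the
        absolute sum is affine in \<open>t\<close> with slope \<open>\<Sum>i\<in>I. sgn (x i) * z i\<close>.\<close>
    let ?r = "\<lambda>i. - (x i / z i)"
    define t where "t = Min (?r ` ?J)"
    have finJ: "finite ?J" using I by simp
    have "t \<in> ?r ` ?J" unfolding t_def by (rule Min_in) (use finJ \<open>?J \<noteq> {}\<close> in auto)
    then obtain k where k: "k \<in> ?J" "t = ?r k" by blast
    have tle: "t \<le> ?r i" if "i \<in> ?J" for i
      unfolding t_def by (rule Min_le) (use finJ that in auto)
    have tpos: "0 \<le> t" using k
      by (auto simp: sgn_if divide_nonpos_pos divide_nonneg_neg divide_le_0_iff split: if_splits)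
    have "\<bar>x i + t * z i\<bar> = \<bar>x i\<bar> + t * (sgn (x i) * z i)" if i: "i \<in> I" for i
    proof (cases "i \<in> ?J")
      case True
      then have "t \<le> ?r i" by (rule tle)
      then have "0 \<le> sgn (x i) * (x i + t * z i)"
        using True by (auto simp: sgn_if field_simps split: if_splits)
      then show ?thesis using True
        by (auto simp: sgn_if abs_if split: if_splits)
    next
      case False
      then have "0 \<le> sgn (x i) * z i" using i by auto
      then show ?thesis using tpos supp[OF i]
        by (cases "x i" "0::'f" rule: linorder_cases)
          (auto simp: sgn_if abs_of_nonneg abs_of_nonpos mult_nonneg_nonpos add_nonpos_nonpos)
    qed
    then have "(\<Sum>i\<in>I. \<bar>x i + t * z i\<bar>) = (\<Sum>i\<in>I. \<bar>x i\<bar>) + t * (\<Sum>i\<in>I. sgn (x i) * z i)"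
      by (simp add: sum.distrib sum_distrib_left)
    also have "\<dots> \<le> (\<Sum>i\<in>I. \<bar>x i\<bar>)" using tpos neg by (simp add: mult_nonneg_nonpos)
    finally have "(\<Sum>i\<in>I. \<bar>x i + t * z i\<bar>) \<le> (\<Sum>i\<in>I. \<bar>x i\<bar>)" .
    moreover have "k \<in> I" "x k \<noteq> 0" "x k + t * z k = 0" using k by auto
    ultimately show ?thesis by blast
  qed
  show ?thesis
  proof (cases "(\<Sum>i\<in>I. sgn (x i) * z i) \<le> 0")
    case True
    then show ?thesis using main[of z] supp nz by blast
  next
    case False
    then have "(\<Sum>i\<in>I. sgn (x i) * - z i) \<le> 0" by (simp add: sum_negf)
    then obtain t where "(\<Sum>i\<in>I. \<bar>x i + t * - z i\<bar>) \<le> (\<Sum>i\<in>I. \<bar>x i\<bar>)"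
      "\<exists>k\<in>I. x k \<noteq> 0 \<and> x k + t * - z k = 0"
      using main[of "\<lambda>i. - z i"] supp nz by auto
    then show ?thesis by (intro exI[of _ "- t"]) simp
  qed
qed

lemma l1_min_attained:
  fixes A :: "('i \<Rightarrow> 'f::linordered_field) set"
  assumes I: "finite I" and ne: "A \<noteq> {}"
    and zero: "\<And>x i. x \<in> A \<Longrightarrow> i \<notin> I \<Longrightarrow> x i = 0"
    and line: "\<And>x y t. x \<in> A \<Longrightarrow> y \<in> A \<Longrightarrow> (\<lambda>i. x i + t * (y i - x i)) \<in> A"
  shows "\<exists>x\<in>A. \<forall>y\<in>A. (\<Sum>i\<in>I. \<bar>x i\<bar>) \<le> (\<Sum>i\<in>I. \<bar>y i\<bar>)"
proof -
  let ?norm = "\<lambda>x. \<Sum>i\<in>I. \<bar>x i\<bar>"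
  let ?supp = "\<lambda>x. {i\<in>I. x i \<noteq> 0}"
  \<comment> \<open>The points whose support contains the support of no other point. They are determined by
      their supports, so there are finitely many.\<close>
  define R where "R = {x\<in>A. \<forall>y\<in>A. ?supp y \<subseteq> ?supp x \<longrightarrow> y = x}"
  have reduce: "x \<in> A \<Longrightarrow> \<exists>y\<in>R. ?norm y \<le> ?norm x" for x
  proof (induction "card (?supp x)" arbitrary: x rule: less_induct)
    case less
    show ?case
    proof (cases "x \<in> R")
      case False
      then obtain y where y: "y \<in> A" "?supp y \<subseteq> ?supp x" "y \<noteq> x"
        using less.prems by (auto simp: R_def)
      define z where "z i = y i - x i" for i
      from y(3) obtain j where j: "y j \<noteq> x j" by blast
      then have "j \<in> I" using zero y(1) less.prems by metis
      then have "\<exists>i\<in>I. z i \<noteq> 0" using j by (auto simp: z_def)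
      moreover have "z i = 0" if "i \<in> I" "x i = 0" for i
        using y(2) that by (auto simp: z_def)
      ultimately obtain t k where t: "?norm (\<lambda>i. x i + t * z i) \<le> ?norm x"
        and k: "k \<in> I" "x k \<noteq> 0" "x k + t * z k = 0"
        using l1_shrink_support[OF I, of x z] by blast
      let ?x = "\<lambda>i. x i + t * z i"
      have A: "?x \<in> A" using line[OF less.prems y(1)] by (simp add: z_def)
      have "?supp ?x \<subset> ?supp x"
        using k y(2) by (auto simp: z_def)
      then have "card (?supp ?x) < card (?supp x)" using I by (intro psubset_card_mono) auto
      from less.hyps[OF this A] t show ?thesis by (meson order_trans)
    qed auto
  qed
  have "inj_on ?supp R" by (rule inj_onI) (auto simp: R_def)
  moreover have "finite (?supp ` R)" by (rule finite_subset[of _ "Pow I"]) (use I in auto)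
  ultimately have fin: "finite (?norm ` R)" by (auto dest: finite_imageD)
  have "R \<noteq> {}" using reduce ne by blast
  then have "Min (?norm ` R) \<in> ?norm ` R" using fin by (intro Min_in) auto
  then obtain x where x: "x \<in> R" "?norm x = Min (?norm ` R)" by auto
  have "?norm x \<le> ?norm y" if "y \<in> A" for y
  proof -
    obtain y' where "y' \<in> R" "?norm y' \<le> ?norm y" using reduce \<open>y \<in> A\<close> by blast
    then show ?thesis using x(2) Min_le[OF fin, of "?norm y'"] by auto
  qed
  then show ?thesis using x(1) by (auto simp: R_def)
qed

section \<open>Admissible complexes and their fillings\<close>

context
  fixes d :: nat and K :: "'a oriented_complex"
  assumes K: "admissible_complex d K"
begin

lemma finite_vertices: "finite (vertices K)"
  using K by (auto simp: admissible_complex_def vertices_def simplicial_complex_def)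

lemma oriented_facet_props:
  assumes "F \<in> oriented_facets K"
  shows "\<bar>fst F\<bar> = 1" "distinct (snd F)" "length (snd F) = d + 1" "set (snd F) \<subseteq> vertices K"
proof -
  obtain s vs where F: "F = (s, vs)" by (cases F)
  have *: "s = 1 \<or> s = -1" "distinct vs" "set vs \<in> facets d K"
    using K assms unfolding admissible_complex_def F by (auto dest!: bij_betwE)
  show "\<bar>fst F\<bar> = 1" "distinct (snd F)" using * by (auto simp: F)
  show "length (snd F) = d + 1" "set (snd F) \<subseteq> vertices K"
    using * distinct_card[of vs] by (auto simp: F facets_def vertices_def)
qed

lemma finite_oriented_facets: "finite (oriented_facets K)"
  using K bij_betw_finite by (fastforce simp: admissible_complex_def facets_def)

lemma facet_chain_in_chains:
  assumes "F \<in> oriented_facets K"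
  shows "facet_chain F \<in> chains d (vertices K)"
proof -
  have "simplex_chain (snd F) \<in> chains d (vertices K)"
    using oriented_facet_props[OF assms] by (intro simplex_chain_in_chains)
  from chains_scale[OF this, of "of_int (fst F)"] show ?thesis
    by (simp add: facet_chain_def[abs_def])
qed

lemma complex_chain_in_chains: "complex_chain K \<in> chains d (vertices K)"
  using chains_sum[OF facet_chain_in_chains] by (simp add: complex_chain_def[abs_def])

text \<open>The cycle condition \<open>\<partial>K = 0\<close>, with the boundary written out.\<close>

lemma sum_complex_chain_Cons: "(\<Sum>v\<in>vertices K. complex_chain K (v # ws)) = 0"
proof -
  have "(\<Sum>v\<in>vertices K. complex_chain K (v # ws)) =
      (\<Sum>F\<in>oriented_facets K. \<Sum>v\<in>vertices K. facet_chain F (v # ws))"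
    unfolding complex_chain_def by (rule sum.swap)
  also have "\<dots> = (\<Sum>F\<in>oriented_facets K. boundary (facet_chain F) ws)"
    using boundary_eq_sum_Cons[OF facet_chain_in_chains finite_vertices] by simp
  finally show ?thesis using K by (simp add: admissible_complex_def)
qed

lemma push_complex_chain:
  assumes "finite U" "vertices K \<subseteq> U"
  shows "push U f (complex_chain K) ws =
    (\<Sum>F\<in>oriented_facets K. of_int (fst F) * simplex_chain (map f (snd F)) ws)"
proof -
  have "complex_chain K = (\<lambda>ws. \<Sum>F\<in>oriented_facets K. of_int (fst F) * simplex_chain (snd F) ws)"
    by (simp add: complex_chain_def[abs_def] facet_chain_def)
  then have "push U f (complex_chain K) ws =
    (\<Sum>F\<in>oriented_facets K. of_int (fst F) * push U f (simplex_chain (snd F)) ws)"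
    by (simp add: push_sum push_scale)
  then show ?thesis
    by (simp add: push_simplex_chain[OF assms(1) subset_trans[OF oriented_facet_props(4) assms(2)]]
        cong: sum.cong)
qed

text \<open>
  The mean, over all vertices \<open>v\<close> of \<open>K\<close>, of the cone over \<open>K\<close> with apex \<open>v\<close>.
  Equivalently it is the simplicial coboundary of \<open>complex_chain K\<close> divided by the number of
  vertices, which is the form used here: the value of the coboundary at \<open>us\<close> is the pairing of
  \<open>K\<close> with the boundary of \<open>us\<close>. Without vertices the quotient is 0.
\<close>

definition mean_cone :: "'a chain" where
  "mean_cone us = (if set us \<subseteq> vertices K
     then (\<Sum>F\<in>oriented_facets K. of_int (fst F) * simplex_boundary us (snd F))
            / of_nat (card (vertices K))
     else 0)"

lemma mean_cone_in_chains: "mean_cone \<in> chains (d + 1) (vertices K)"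
proof (rule chainsI)
  show "alternating mean_cone"
  proof (rule alternatingI_swap)
    show "mean_cone (a @ y # x # b) = - mean_cone (a @ x # y # b)" for a x y b
      using simplex_boundary_swap[of a y x b] by (auto simp: mean_cone_def sum_negf)
  qed
  fix us assume nz: "mean_cone us \<noteq> 0"
  then have "\<exists>F\<in>oriented_facets K. simplex_boundary us (snd F) \<noteq> 0"
    unfolding mean_cone_def by (metis (no_types, lifting) div_0 mult_zero_right sum.neutral)
  then obtain F v where F: "F \<in> oriented_facets K" "mset us = add_mset v (mset (snd F))"
    using simplex_boundary_nonzero by blast
  then have "length us = Suc (length (snd F))" by (metis size_add_mset size_mset)
  then show "length us = d + 1 + 1 \<and> set us \<subseteq> vertices K"
    using oriented_facet_props(3)[OF F(1)] nz by (auto simp: mean_cone_def split: if_splits)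
qed

lemma mean_cone_Cons:
  assumes "v \<in> vertices K" "set ws \<subseteq> vertices K"
  shows "mean_cone (v # ws) =
    (complex_chain K ws - (\<Sum>i<length ws. (-1) ^ i * complex_chain K (v # delete_nth i ws)))
      / of_nat (card (vertices K))"
proof -
  have c: "complex_chain K us = (\<Sum>F\<in>oriented_facets K. of_int (fst F) * simplex_chain us (snd F))"
    for us by (simp add: complex_chain_def facet_chain_def simplex_chain_commute[of us])
  have "(\<Sum>F\<in>oriented_facets K. of_int (fst F) * simplex_boundary (v # ws) (snd F)) =
     complex_chain K ws - (\<Sum>F\<in>oriented_facets K. \<Sum>i<length ws.
       (-1) ^ i * (of_int (fst F) * simplex_chain (v # delete_nth i ws) (snd F)))"
    by (simp add: c simplex_boundary_Cons right_diff_distrib sum_subtractf sum_distrib_left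
        mult.left_commute)
  also have "\<dots> = complex_chain K ws -
      (\<Sum>i<length ws. (-1) ^ i * complex_chain K (v # delete_nth i ws))"
    unfolding c by (subst sum.swap) (simp add: sum_distrib_left)
  finally show ?thesis using assms by (simp add: mean_cone_def)
qed

text \<open>
  On all of the simplices over \<open>N\<close> vertices, \<open>\<partial>\<delta> + \<delta>\<partial>\<close> is multiplication by \<open>N\<close>; hence
  \<open>\<partial>\<delta>c = N c\<close> for a cycle \<open>c\<close>.
\<close>

lemma boundary_mean_cone: "boundary mean_cone = complex_chain K"
proof
  fix ws
  let ?V = "vertices K"
  have b: "boundary mean_cone ws = (\<Sum>v\<in>?V. mean_cone (v # ws))"
    by (rule boundary_eq_sum_Cons[OF mean_cone_in_chains finite_vertices])
  show "boundary mean_cone ws = complex_chain K ws"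
  proof (cases "set ws \<subseteq> ?V \<and> ?V \<noteq> {}")
    case True
    have "(\<Sum>v\<in>?V. \<Sum>i<length ws. (-1) ^ i * complex_chain K (v # delete_nth i ws)) =
        (\<Sum>i<length ws. (-1) ^ i * (\<Sum>v\<in>?V. complex_chain K (v # delete_nth i ws)))"
      by (subst sum.swap) (simp add: sum_distrib_left)
    also have "\<dots> = 0" by (simp add: sum_complex_chain_Cons)
    finally have "(\<Sum>v\<in>?V. mean_cone (v # ws)) =
        of_nat (card ?V) * complex_chain K ws / of_nat (card ?V)"
      using True by (simp add: mean_cone_Cons sum_subtractf sum_divide_distrib[symmetric])
    then show ?thesis using b True finite_vertices by (simp add: card_eq_0_iff)
  next
    case False
    have "complex_chain K ws = 0"
      using False complex_chain_in_chains by (auto simp: chains_def)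
    moreover have "mean_cone (v # ws) = 0" if "v \<in> ?V" for v
      using False that by (auto simp: mean_cone_def)
    ultimately show ?thesis using b by simp
  qed
qed

text \<open>The chains with boundary \<open>K\<close> over which \<open>VQ d K\<close> is the minimum.\<close>

definition fillings :: "'a chain set" where
  "fillings = {\<alpha> \<in> chains (d + 1) (vertices K). boundary \<alpha> = complex_chain K}"

text \<open>The least element in the definition of \<open>VQ\<close> exists.\<close>

lemma VQ_minimum:
  "(\<exists>\<alpha>\<in>fillings. chain_norm \<alpha> = VQ d K) \<and> (\<forall>\<alpha>\<in>fillings. VQ d K \<le> chain_norm \<alpha>)"
proof -
  let ?V = "vertices K"
  let ?L = "ordered_simplices (d + 1) ?V"
  have b: "boundary \<alpha> ws = (\<Sum>v\<in>?V. \<alpha> (v # ws))" if "\<alpha> \<in> chains (d + 1) ?V" for \<alpha> ws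
    using boundary_eq_sum_Cons[OF that finite_vertices] .
  have norm: "(\<Sum>us\<in>?L. \<bar>\<alpha> us\<bar>) = fact (d + 1 + 1) * chain_norm \<alpha>" if "\<alpha> \<in> fillings" for \<alpha>
    using that by (intro sum_ordered_simplices_abs finite_vertices) (simp add: fillings_def)
  have "\<exists>\<alpha>\<in>fillings. \<forall>\<beta>\<in>fillings. (\<Sum>us\<in>?L. \<bar>\<alpha> us\<bar>) \<le> (\<Sum>us\<in>?L. \<bar>\<beta> us\<bar>)"
  proof (rule l1_min_attained)
    show "finite ?L" by (rule finite_lists_length_eq[OF finite_vertices])
    show "fillings \<noteq> {}"
      using mean_cone_in_chains boundary_mean_cone by (auto simp: fillings_def)
    show "\<alpha> us = 0" if "\<alpha> \<in> fillings" "us \<notin> ?L" for \<alpha> us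
      using that by (auto simp: fillings_def chains_def)
    show "(\<lambda>us. \<alpha> us + t * (\<beta> us - \<alpha> us)) \<in> fillings"
      if "\<alpha> \<in> fillings" "\<beta> \<in> fillings" for \<alpha> \<beta> t
    proof -
      have ch: "\<alpha> \<in> chains (d + 1) ?V" "\<beta> \<in> chains (d + 1) ?V"
        and bd: "boundary \<alpha> = complex_chain K" "boundary \<beta> = complex_chain K"
        using that by (auto simp: fillings_def)
      let ?g = "\<lambda>us. (1 - t) * \<alpha> us + t * \<beta> us"
      have g: "?g \<in> chains (d + 1) ?V" by (intro chains_add chains_scale ch)
      have "boundary ?g ws = complex_chain K ws" for ws
      proof -
        have "boundary ?g ws = (1 - t) * boundary \<alpha> ws + t * boundary \<beta> ws"
          by (simp add: b[OF g] b[OF ch(1)] b[OF ch(2)] sum.distrib sum_distrib_left)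
        then show ?thesis by (simp add: bd algebra_simps)
      qed
      then have "?g \<in> fillings" using g by (auto simp: fillings_def)
      then show ?thesis by (simp add: algebra_simps)
    qed
  qed
  then obtain \<alpha> where \<alpha>: "\<alpha> \<in> fillings"
    and min: "\<And>\<beta>. \<beta> \<in> fillings \<Longrightarrow> (\<Sum>us\<in>?L. \<bar>\<alpha> us\<bar>) \<le> (\<Sum>us\<in>?L. \<bar>\<beta> us\<bar>)"
    by blast
  have le: "chain_norm \<alpha> \<le> chain_norm \<beta>" if "\<beta> \<in> fillings" for \<beta>
    using min[OF that] by (simp only: norm[OF \<alpha>] norm[OF that] mult_le_cancel_left_pos[OF fact_gt_zero])
  have "VQ d K = chain_norm \<alpha>"
    unfolding VQ_def by (rule Least_equality) (use \<alpha> le in \<open>auto simp: fillings_def\<close>)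
  then show ?thesis using \<alpha> le by auto
qed

lemma VQ_le:
  "\<alpha> \<in> chains (d + 1) (vertices K) \<Longrightarrow> boundary \<alpha> = complex_chain K \<Longrightarrow>
    VQ d K \<le> chain_norm \<alpha>"
  using VQ_minimum by (auto simp: fillings_def)

lemma VQ_attained:
  obtains \<alpha> where "\<alpha> \<in> chains (d + 1) (vertices K)" "boundary \<alpha> = complex_chain K"
    "chain_norm \<alpha> = VQ d K"
  using VQ_minimum by (auto simp: fillings_def)

end

lemma complex_chain_disjoint_union:
  assumes K: "admissible_complex d K" and K': "admissible_complex d K'"
  shows "complex_chain (K \<squnion>\<^sub>c K') ws =
    push (vertices K) Inl (complex_chain K) ws + push (vertices K') Inr (complex_chain K') ws"
proof -
  let ?l = "map_prod id (map Inl) :: int \<times> 'a list \<Rightarrow> int \<times> ('a + 'b) list"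
  let ?r = "map_prod id (map Inr) :: int \<times> 'b list \<Rightarrow> int \<times> ('a + 'b) list"
  have "?l F \<noteq> ?r G" if "F \<in> oriented_facets K" "G \<in> oriented_facets K'" for F G
  proof -
    have "snd F \<noteq> []" using oriented_facet_props(3)[OF K that(1)] by auto
    then show ?thesis by (cases F; cases G; cases "snd F"; cases "snd G") auto
  qed
  then have disj: "?l ` oriented_facets K \<inter> ?r ` oriented_facets K' = {}"
    by (intro equals0I) (elim IntE imageE, metis)
  have inj: "inj ?l" "inj ?r" by (auto intro!: prod.inj_map list.inj_map)
  have "complex_chain (K \<squnion>\<^sub>c K') ws =
      (\<Sum>F\<in>?l ` oriented_facets K. facet_chain F ws) + (\<Sum>F\<in>?r ` oriented_facets K'. facet_chain F ws)"
    using finite_oriented_facets[OF K] finite_oriented_facets[OF K'] disj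
    by (simp add: complex_chain_def disjoint_union_def sum.union_disjoint)
  then show ?thesis
    using inj by (simp add: sum.reindex inj_on_subset[OF _ subset_UNIV] facet_chain_def
        push_complex_chain[OF K finite_vertices[OF K]] push_complex_chain[OF K' finite_vertices[OF K']])
qed

section \<open>Dimension zero\<close>

lemma sum_ordered_pairs:
  "(\<Sum>us\<in>ordered_simplices 1 V. g us) = (\<Sum>v\<in>V. \<Sum>w\<in>V. g [v, w])"
proof -
  have "ordered_simplices 1 V = (\<lambda>(v, w). [v, w]) ` (V \<times> V)"
    by (auto simp: length_Suc_conv numeral_2_eq_2 image_iff)
  then show ?thesis
    by (simp add: sum.reindex inj_on_def sum.cartesian_product case_prod_unfold)
qed

lemma abs_complex_chain_vertex:
  assumes K: "admissible_complex 0 K" and v: "v \<in> vertices K"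
  shows "\<bar>complex_chain K [v]\<bar> = 1"
proof -
  have bij: "bij_betw (\<lambda>(s, vs). set vs) (oriented_facets K) (facets 0 K)"
    using K by (simp add: admissible_complex_def)
  obtain S T where "v \<in> S" "S \<subseteq> T" "T \<in> facets 0 K"
    using K v unfolding admissible_complex_def vertices_def by blast
  then have "{v} \<in> facets 0 K" by (auto simp: facets_def card_1_singleton_iff)
  then have "{v} \<in> (\<lambda>(s, vs). set vs) ` oriented_facets K"
    using bij by (simp add: bij_betw_def)
  then obtain F where F: "F \<in> oriented_facets K" "set (snd F) = {v}"
    by force
  then have sF: "snd F = [v]"
    using oriented_facet_props(3)[OF K F(1)] by (auto simp: length_Suc_conv)
  have "facet_chain G [v] = 0" if G: "G \<in> oriented_facets K - {F}" for G
  proof (rule ccontr)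
    assume "facet_chain G [v] \<noteq> 0"
    then have "set [v] = set (snd G)"
      by (intro mset_eq_setD simplex_chain_nonzero) (auto simp: facet_chain_def)
    then have "G = F"
      using bij F G by (auto simp: bij_betw_def inj_on_def case_prod_unfold)
    then show False using G by simp
  qed
  then have "complex_chain K [v] = facet_chain F [v]"
    unfolding complex_chain_def
    using F(1) finite_oriented_facets[OF K] by (simp add: sum.remove)
  then show ?thesis
    using oriented_facet_props(1)[OF K F(1)] simplex_chain_self[of "[v]"]
    by (auto simp: facet_chain_def sF abs_mult simp flip: of_int_abs)
qed

lemma VQ_dim_0:
  assumes K: "admissible_complex 0 K"
  shows "2 * VQ 0 K = of_nat (card (vertices K))"
proof (rule antisym)
  let ?V = "vertices K"
  let ?c = "\<lambda>v. complex_chain K [v]"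
  note V = finite_vertices[OF K]
  have norm: "(\<Sum>v\<in>?V. \<Sum>w\<in>?V. \<bar>\<alpha> [v, w]\<bar>) = 2 * chain_norm \<alpha>"
    if "\<alpha> \<in> chains (0 + 1) ?V" for \<alpha>
    using sum_ordered_simplices_abs[OF that V] sum_ordered_pairs[of "\<lambda>us. \<bar>\<alpha> us\<bar>" ?V]
    by (simp add: numeral_2_eq_2)
  \<comment> \<open>For coefficients \<open>\<plusminus>1\<close> one has \<open>\<bar>a - b\<bar> = 1 - a * b\<close>, and the products sum to 0 since the
      coefficients do.\<close>
  have mc: "\<bar>mean_cone K [v, w]\<bar> = (1 - ?c v * ?c w) / of_nat (card ?V)"
    if "v \<in> ?V" "w \<in> ?V" for v w
  proof -
    have "?c v = 1 \<or> ?c v = -1" "?c w = 1 \<or> ?c w = -1"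
      using abs_complex_chain_vertex[OF K that(1)] abs_complex_chain_vertex[OF K that(2)]
      by linarith+
    then have "\<bar>?c w - ?c v\<bar> = 1 - ?c v * ?c w" by auto
    moreover have "mean_cone K [v, w] = (?c w - ?c v) / of_nat (card ?V)"
      using mean_cone_Cons[OF K, of v "[w]"] that by (simp add: delete_nth_def)
    ultimately show ?thesis by simp
  qed
  have "(\<Sum>v\<in>?V. \<Sum>w\<in>?V. ?c v * ?c w) = 0"
    by (simp add: sum_complex_chain_Cons[OF K] flip: sum_distrib_left)
  then have "(\<Sum>v\<in>?V. \<Sum>w\<in>?V. \<bar>mean_cone K [v, w]\<bar>) = of_nat (card ?V)"
    by (simp add: mc sum_subtractf flip: sum_divide_distrib)
  then show "2 * VQ 0 K \<le> of_nat (card ?V)"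
    using VQ_le[OF K mean_cone_in_chains[OF K] boundary_mean_cone[OF K]]
      norm[OF mean_cone_in_chains[OF K]] by simp
  obtain \<alpha> where \<alpha>: "\<alpha> \<in> chains (0 + 1) ?V" "boundary \<alpha> = complex_chain K"
    "chain_norm \<alpha> = VQ 0 K"
    using VQ_attained[OF K] .
  have "of_nat (card ?V) = (\<Sum>w\<in>?V. \<bar>?c w\<bar>)"
    by (simp add: abs_complex_chain_vertex[OF K])
  also have "\<dots> = (\<Sum>w\<in>?V. \<bar>\<Sum>v\<in>?V. \<alpha> [v, w]\<bar>)"
    by (simp add: boundary_eq_sum_Cons[OF \<alpha>(1) V] flip: \<alpha>(2))
  also have "\<dots> \<le> (\<Sum>w\<in>?V. \<Sum>v\<in>?V. \<bar>\<alpha> [v, w]\<bar>)"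
    by (intro sum_mono sum_abs)
  also have "\<dots> = 2 * VQ 0 K"
    using norm[OF \<alpha>(1)] \<alpha>(3) by (subst sum.swap) simp
  finally show "of_nat (card ?V) \<le> 2 * VQ 0 K" .
qed

section \<open>Additivity\<close>

lemma chains_singleton:
  assumes "c \<in> chains n {v}" "n \<ge> 1"
  shows "c us = 0"
proof (rule ccontr)
  assume "c us \<noteq> 0"
  then have us: "distinct us" "length us = n + 1" "set us \<subseteq> {v}"
    using assms by (auto simp: chains_def)
  then have "length us \<le> card {v}" using card_mono[of "{v}" "set us"] by (simp add: distinct_card)
  then show False using us assms by simp
qed

text \<open>
  If \<open>K\<close> has no vertices, there is none to collapse \<open>K'\<close> to. An arbitrary point outside
  serves as well, since a single point carries no simplices of positive dimension.
\<close>

lemma chains_insert_base: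
  assumes "n \<ge> 1" "V = {} \<or> v \<in> V"
  shows "chains n (insert v V) = chains n V"
proof (cases "V = {}")
  case True
  have "c \<in> chains n {}" if "c \<in> chains n {v}" for c
  proof -
    have "c = (\<lambda>_. 0)" using chains_singleton[OF that assms(1)] by blast
    then show ?thesis by (simp add: chains_def)
  qed
  moreover have "chains n {} \<subseteq> chains n {v}" by (rule chains_mono) simp
  ultimately show ?thesis using True by auto
qed (use assms in \<open>simp add: insert_absorb\<close>)

text \<open>
  If \<open>f\<close> sends a chain \<open>\<gamma>\<close> to a filling of \<open>K\<close>, then the simplices of \<open>\<gamma>\<close> that stay
  nondegenerate under \<open>f\<close> already weigh at least \<open>VQ d K\<close>.
\<close>

lemma VQ_le_collapse:
  assumes K: "admissible_complex d K" and d: "d \<ge> 1" and U: "finite U"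
    and \<gamma>: "\<gamma> \<in> chains (d + 1) U" and v: "vertices K = {} \<or> v \<in> vertices K"
    and f: "f ` U \<subseteq> insert v (vertices K)"
    and fill: "push U f (boundary \<gamma>) = complex_chain K"
  shows "fact (d + 2) * VQ d K
      \<le> (\<Sum>us | us \<in> ordered_simplices (d + 1) U \<and> distinct (map f us). \<bar>\<gamma> us\<bar>)"
proof -
  let ?W = "insert v (vertices K)"
  have W: "finite ?W" using finite_vertices[OF K] by simp
  have p: "push U f \<gamma> \<in> chains (d + 1) ?W" by (rule push_in_chains[OF \<gamma> f])
  then have "push U f \<gamma> \<in> chains (d + 1) (vertices K)"
    using chains_insert_base[of "d + 1" "vertices K" v] v by simp
  then have "VQ d K \<le> chain_norm (push U f \<gamma>)"
    using fill by (intro VQ_le[OF K]) (simp_all add: boundary_push[OF \<gamma> U W f])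
  then have "fact (d + 1 + 1) * VQ d K \<le> fact (d + 1 + 1) * chain_norm (push U f \<gamma>)"
    by (simp only: mult_le_cancel_left_pos[OF fact_gt_zero])
  also have "\<dots> = (\<Sum>ws\<in>ordered_simplices (d + 1) ?W. \<bar>push U f \<gamma> ws\<bar>)"
    by (rule sum_ordered_simplices_abs[symmetric, OF p W])
  also have "\<dots> \<le> (\<Sum>us | us \<in> ordered_simplices (d + 1) U \<and> distinct (map f us). \<bar>\<gamma> us\<bar>)"
    by (rule sum_abs_push_le[OF \<gamma> U W f])
  finally show ?thesis by simp
qed

lemma VQ_disjoint_union_le:
  assumes K: "admissible_complex d K" and K': "admissible_complex d K'"
  shows "VQ d (K \<squnion>\<^sub>c K') \<le> VQ d K + VQ d K'"
proof -
  let ?U = "vertices (K \<squnion>\<^sub>c K')"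
  note adm = admissible_disjoint_union[OF K K']
  note fin = finite_vertices[OF K] finite_vertices[OF K'] finite_vertices[OF adm]
  have i: "Inl ` vertices K \<subseteq> ?U" "Inr ` vertices K' \<subseteq> ?U"
    by (auto simp: vertices_disjoint_union)
  obtain \<alpha> where \<alpha>: "\<alpha> \<in> chains (d + 1) (vertices K)" "boundary \<alpha> = complex_chain K"
    "chain_norm \<alpha> = VQ d K" using VQ_attained[OF K] .
  obtain \<beta> where \<beta>: "\<beta> \<in> chains (d + 1) (vertices K')" "boundary \<beta> = complex_chain K'"
    "chain_norm \<beta> = VQ d K'" using VQ_attained[OF K'] .
  let ?a = "push (vertices K) Inl \<alpha> :: ('a + 'b) chain"
  let ?b = "push (vertices K') Inr \<beta> :: ('a + 'b) chain"
  let ?g = "\<lambda>us. ?a us + ?b us"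
  have ab: "?a \<in> chains (d + 1) ?U" "?b \<in> chains (d + 1) ?U"
    using push_in_chains[OF \<alpha>(1) i(1)] push_in_chains[OF \<beta>(1) i(2)] by auto
  then have g: "?g \<in> chains (d + 1) ?U" by (rule chains_add)
  have "boundary ?g ws = complex_chain (K \<squnion>\<^sub>c K') ws" for ws
  proof -
    have "boundary ?g ws = boundary ?a ws + boundary ?b ws"
      by (simp add: boundary_eq_sum_Cons[OF g fin(3)] boundary_eq_sum_Cons[OF ab(1) fin(3)]
          boundary_eq_sum_Cons[OF ab(2) fin(3)] sum.distrib)
    then show ?thesis
      by (simp add: boundary_push[OF \<alpha>(1) fin(1) fin(3) i(1)] \<alpha>(2) \<beta>(2)
          boundary_push[OF \<beta>(1) fin(2) fin(3) i(2)] complex_chain_disjoint_union[OF K K'])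
  qed
  then have "VQ d (K \<squnion>\<^sub>c K') \<le> chain_norm ?g" by (intro VQ_le[OF adm g]) auto
  also have "chain_norm ?g \<le> chain_norm ?a + chain_norm ?b"
  proof -
    let ?L = "ordered_simplices (d + 1) ?U"
    have "(\<Sum>us\<in>?L. \<bar>?g us\<bar>) \<le> (\<Sum>us\<in>?L. \<bar>?a us\<bar>) + (\<Sum>us\<in>?L. \<bar>?b us\<bar>)"
      by (simp only: sum.distrib[symmetric] sum_mono abs_triangle_ineq)
    then show ?thesis
      by (simp only: sum_ordered_simplices_abs[OF g fin(3)] sum_ordered_simplices_abs[OF ab(1) fin(3)]
          sum_ordered_simplices_abs[OF ab(2) fin(3)] distrib_left[symmetric]
          mult_le_cancel_left_pos[OF fact_gt_zero])
  qed
  also have "\<dots> \<le> VQ d K + VQ d K'"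
    using chain_norm_push_le[OF \<alpha>(1) fin(1) fin(3) i(1)]
      chain_norm_push_le[OF \<beta>(1) fin(2) fin(3) i(2)] by (simp add: \<alpha>(3) \<beta>(3))
  finally show ?thesis .
qed

lemma VQ_disjoint_union_ge:
  assumes K: "admissible_complex d K" and K': "admissible_complex d K'" and d: "d \<ge> 1"
  shows "VQ d K + VQ d K' \<le> VQ d (K \<squnion>\<^sub>c K')"
proof -
  let ?V = "vertices K" and ?V' = "vertices K'"
  let ?U = "vertices (K \<squnion>\<^sub>c K')"
  let ?c = "complex_chain (K \<squnion>\<^sub>c K')"
  note adm = admissible_disjoint_union[OF K K']
  note fin = finite_vertices[OF K] finite_vertices[OF K'] finite_vertices[OF adm]
  have i: "Inl ` ?V \<subseteq> ?U" "Inr ` ?V' \<subseteq> ?U"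
    by (auto simp: vertices_disjoint_union)
  obtain v v' where v: "?V = {} \<or> v \<in> ?V" and v': "?V' = {} \<or> v' \<in> ?V'" by blast
  obtain \<gamma> where \<gamma>: "\<gamma> \<in> chains (d + 1) ?U" "boundary \<gamma> = ?c"
    "chain_norm \<gamma> = VQ d (K \<squnion>\<^sub>c K')" using VQ_attained[OF adm] .
  define f :: "'a + 'b \<Rightarrow> 'a" where "f = case_sum id (\<lambda>_. v)"
  define f' :: "'a + 'b \<Rightarrow> 'b" where "f' = case_sum (\<lambda>_. v') id"
  have push_c: "push ?U h ?c ws = push ?V (h \<circ> Inl) (complex_chain K) ws +
      push ?V' (h \<circ> Inr) (complex_chain K') ws" for h :: "'a + 'b \<Rightarrow> 'c" and ws
  proof -
    have "?c = (\<lambda>ws. push ?V Inl (complex_chain K) ws + push ?V' Inr (complex_chain K') ws)"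
      using complex_chain_disjoint_union[OF K K'] by blast
    then show ?thesis
      by (simp add: push_add push_push[OF fin(1) fin(3) i(1)] push_push[OF fin(2) fin(3) i(2)])
  qed
  have const: "push W (\<lambda>_. x) c ws = 0" if "c \<in> chains d W"
    for W and x :: 'c and c :: "'d chain" and ws
    by (rule chains_singleton[OF push_in_chains[OF that] d]) auto
  have "push ?U f ?c = complex_chain K"
    by (rule ext) (simp add: push_c f_def o_def const[OF complex_chain_in_chains[OF K']]
        push_identity[OF complex_chain_in_chains[OF K]])
  then have le: "fact (d + 2) * VQ d K \<le>
      (\<Sum>us | us \<in> ordered_simplices (d + 1) ?U \<and> distinct (map f us). \<bar>\<gamma> us\<bar>)"
    by (intro VQ_le_collapse[OF K d fin(3) \<gamma>(1) v])
      (auto simp: f_def \<gamma>(2) vertices_disjoint_union)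
  have "push ?U f' ?c = complex_chain K'"
    by (rule ext) (simp add: push_c f'_def o_def const[OF complex_chain_in_chains[OF K]]
        push_identity[OF complex_chain_in_chains[OF K']])
  then have le': "fact (d + 2) * VQ d K' \<le>
      (\<Sum>us | us \<in> ordered_simplices (d + 1) ?U \<and> distinct (map f' us). \<bar>\<gamma> us\<bar>)"
    by (intro VQ_le_collapse[OF K' d fin(3) \<gamma>(1) v'])
      (auto simp: f'_def \<gamma>(2) vertices_disjoint_union)
  let ?L = "ordered_simplices (d + 1) ?U"
  let ?A = "{us. us \<in> ?L \<and> distinct (map f us)}"
  let ?A' = "{us. us \<in> ?L \<and> distinct (map f' us)}"
  have "us \<notin> ?A'" if A: "us \<in> ?A" for us
  proof
    assume A': "us \<in> ?A'"
    \<comment> \<open>Two of any three vertices lie in the same complex, and one of \<open>f\<close>, \<open>f'\<close> identifies them.\<close>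
    have "length us = Suc (Suc (Suc (d - 1)))" using A d by auto
    then obtain x y z us' where us: "us = x # y # z # us'" by (auto simp: length_Suc_conv)
    have "distinct [f x, f y, f z]" "distinct [f' x, f' y, f' z]" using A A' us by auto
    then show False by (auto simp: f_def f'_def split: sum.splits)
  qed
  then have disj: "?A \<inter> ?A' = {}" by blast
  have finL: "finite ?L" by (rule finite_lists_length_eq[OF fin(3)])
  have finA: "finite ?A" "finite ?A'" by (rule finite_subset[OF _ finL]; blast)+
  have "fact (d + 2) * (VQ d K + VQ d K') \<le> (\<Sum>us\<in>?A. \<bar>\<gamma> us\<bar>) + (\<Sum>us\<in>?A'. \<bar>\<gamma> us\<bar>)"
    using le le' by (simp only: distrib_left add_mono)
  also have "\<dots> = (\<Sum>us\<in>?A \<union> ?A'. \<bar>\<gamma> us\<bar>)"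
    by (rule sum.union_disjoint[symmetric, OF finA disj])
  also have "\<dots> \<le> (\<Sum>us\<in>?L. \<bar>\<gamma> us\<bar>)" by (rule sum_mono2[OF finL]) auto
  also have "\<dots> = fact (d + 2) * VQ d (K \<squnion>\<^sub>c K')"
    using sum_ordered_simplices_abs[OF \<gamma>(1) fin(3)] \<gamma>(3) by simp
  finally show ?thesis by (simp only: mult_le_cancel_left_pos[OF fact_gt_zero])
qed

theorem theorem1:
  fixes d :: nat
    and K :: "'a oriented_complex"
    and K' :: "'b oriented_complex"
  assumes "admissible_complex d K"
    and "admissible_complex d K'"
  shows "VQ d (K \<squnion>\<^sub>c K') = VQ d K + VQ d K'"
proof (cases "d = 0")
  case True
  have "card (vertices (K \<squnion>\<^sub>c K')) = card (vertices K) + card (vertices K')"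
    using finite_vertices[OF assms(1)] finite_vertices[OF assms(2)]
    by (simp add: vertices_disjoint_union card_Plus flip: Plus_def)
  then show ?thesis
    using assms VQ_dim_0[of K] VQ_dim_0[of K'] VQ_dim_0[of "K \<squnion>\<^sub>c K'"]
      admissible_disjoint_union[of d K K'] True by simp
next
  case False
  then show ?thesis
    using VQ_disjoint_union_le[OF assms] VQ_disjoint_union_ge[OF assms] by simp
qed

end
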